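(* Let $X$ be a countably infinite set and $\Sigma$ a non-empty finite subset of $X$. Then the maximal subsemigroups of $I_X$ which contain the pointwise stabiliser $\operatorname{Sym}(X)_{(\Sigma)}$ but not $\operatorname{Sym}(X)$ are exactly the following: $$P_{\Gamma} = \{ f \in I_X \mid \Gamma \not\subseteq \operatorname{dom}(f) \text{ or } \Gamma f = \Gamma \} \cup \mathfrak{F}_X,$$ $$P_{\Gamma}^{-1} = \{ f \in I_X \mid \Gamma \not\subseteq \operatorname{im}(f) \text{ or } \Gamma f = \Gamma \} \cup \mathfrak{F}_X,$$ $$Q_{\Gamma} = \{ f \in I_X \mid \Gamma \not\subseteq \operatorname{dom}(f) \text{ or } (\Gamma f = \Gamma \text{ and } d(f) < \aleph_0) \text{ or } c(f) = \aleph_0 \},$$ $$Q_{\Gamma}^{-1} = \{ f \in I_X \mid \Gamma \not\subseteq \operatorname{im}(f) \text{ or } (\Gamma f = \Gamma \text{ and } c(f) < \aleph_0) \text{ or } d(f) = \aleph_0 \},$$ where $\Gamma$ ranges over the non-empty subsets of $\Sigma$.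
   Context: For a set $X$, $I_X$ is the symmetric inverse monoid: the set of all bijections between subsets of $X$ (partial bijections, called charts) under composition of partial functions, written left to right (the image of $x$ under $f$ is $xf$). For $\Gamma \subseteq X$, $\Gamma f = \{ xf \mid x \in \Gamma \cap \operatorname{dom}(f)\}$. $\operatorname{Sym}(X) \subseteq I_X$ is the group of all permutations of $X$, and $\operatorname{Sym}(X)_{(\Sigma)} = \{ f \in \operatorname{Sym}(X) \mid yf = y \text{ for all } y \in \Sigma\}$. For $f \in I_X$, the defect is $d(f) = |X \setminus \operatorname{im}(f)|$ and the collapse is $c(f) = |X \setminus \operatorname{dom}(f)|$. $\mathfrak{F}_X = \{ f \in I_X \mid |\operatorname{im}(f)| < |X| \}$ (for countably infinite $X$: the charts with finite domain). A maximal subsemigroup of $I_X$ is a proper subsemigroup that is maximal under containment among the proper subsemigroups of $I_X$. *)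

theory Defs
  imports "HOL-Algebra.Group" "HOL-Library.Countable_Set"
begin

unbundle cardinal_syntax

text \<open>
  Charts on \<open>X\<close> are partial functions \<open>'a \<rightharpoonup> 'a\<close>. Products are written left to right, so
  the product \<open>f g\<close> is \<^term>\<open>g \<circ>\<^sub>m f\<close>, and \<open>im f\<close> is \<^term>\<open>ran f\<close>. Cardinalities are those of
  the library's cardinal theory, with \<^term>\<open>natLeq\<close> for \<open>\<aleph>\<^sub>0\<close>.
\<close>

definition charts :: "'a set \<Rightarrow> ('a \<rightharpoonup> 'a) set" where
  "charts X = {f. dom f \<subseteq> X \<and> ran f \<subseteq> X \<and> inj_on f (dom f)}"

definition sym_inv_monoid :: "'a set \<Rightarrow> ('a \<rightharpoonup> 'a) monoid" where
  "sym_inv_monoid X =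
     \<lparr>carrier = charts X, mult = (\<lambda>f g. g \<circ>\<^sub>m f), one = (\<lambda>x. if x \<in> X then Some x else None)\<rparr>"

lemma monoid_sym_inv_monoid: "monoid (sym_inv_monoid X)"
proof (rule monoidI)
  fix f g
  assume "f \<in> carrier (sym_inv_monoid X)" "g \<in> carrier (sym_inv_monoid X)"
  then have f: "dom f \<subseteq> X" "ran f \<subseteq> X" "inj_on f (dom f)"
    and g: "dom g \<subseteq> X" "ran g \<subseteq> X" "inj_on g (dom g)"
    by (auto simp: sym_inv_monoid_def charts_def)
  have "dom (g \<circ>\<^sub>m f) \<subseteq> X" "ran (g \<circ>\<^sub>m f) \<subseteq> X"
    using f(1) g(2) by (auto simp: map_comp_def ran_def split: option.splits)
  moreover have "inj_on (g \<circ>\<^sub>m f) (dom (g \<circ>\<^sub>m f))"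
  proof (rule inj_onI)
    fix x y
    assume x: "x \<in> dom (g \<circ>\<^sub>m f)" and y: "y \<in> dom (g \<circ>\<^sub>m f)" and eq: "(g \<circ>\<^sub>m f) x = (g \<circ>\<^sub>m f) y"
    from x obtain u where u: "f x = Some u" "u \<in> dom g"
      by (cases "f x") (auto simp: map_comp_def dom_def)
    from y obtain v where v: "f y = Some v" "v \<in> dom g"
      by (cases "f y") (auto simp: map_comp_def dom_def)
    note uv = u v
    from uv eq have "g u = g v" by (simp add: map_comp_def)
    with uv g(3) have "u = v" by (simp add: inj_on_eq_iff)
    with uv f(3) show "x = y" by (simp add: inj_on_def dom_def)
  qed
  ultimately show "f \<otimes>\<^bsub>sym_inv_monoid X\<^esub> g \<in> carrier (sym_inv_monoid X)"
    by (simp add: sym_inv_monoid_def charts_def)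
next
  show "\<one>\<^bsub>sym_inv_monoid X\<^esub> \<in> carrier (sym_inv_monoid X)"
    by (auto simp: sym_inv_monoid_def charts_def inj_on_def ran_def split: if_splits)
next
  fix f
  assume "f \<in> carrier (sym_inv_monoid X)"
  then have f: "dom f \<subseteq> X" "ran f \<subseteq> X"
    by (simp_all add: sym_inv_monoid_def charts_def)
  show "\<one>\<^bsub>sym_inv_monoid X\<^esub> \<otimes>\<^bsub>sym_inv_monoid X\<^esub> f = f"
  proof
    fix x
    show "(\<one>\<^bsub>sym_inv_monoid X\<^esub> \<otimes>\<^bsub>sym_inv_monoid X\<^esub> f) x = f x"
      using f(1) by (cases "f x") (auto simp: sym_inv_monoid_def map_comp_def)
  qed
  show "f \<otimes>\<^bsub>sym_inv_monoid X\<^esub> \<one>\<^bsub>sym_inv_monoid X\<^esub> = f"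
  proof
    fix x
    show "(f \<otimes>\<^bsub>sym_inv_monoid X\<^esub> \<one>\<^bsub>sym_inv_monoid X\<^esub>) x = f x"
      using f(2) by (cases "f x") (auto simp: sym_inv_monoid_def map_comp_def dest: ranI)
  qed
next
  fix f g h
  show "f \<otimes>\<^bsub>sym_inv_monoid X\<^esub> g \<otimes>\<^bsub>sym_inv_monoid X\<^esub> h =
        f \<otimes>\<^bsub>sym_inv_monoid X\<^esub> (g \<otimes>\<^bsub>sym_inv_monoid X\<^esub> h)"
    by (simp add: sym_inv_monoid_def map_comp_def fun_eq_iff split: option.split)
qed

definition subsemigroup :: "('a, 'b) monoid_scheme \<Rightarrow> 'a set \<Rightarrow> bool" where
  "subsemigroup G S \<longleftrightarrow>
     S \<subseteq> carrier G \<and> S \<noteq> {} \<and> (\<forall>x\<in>S. \<forall>y\<in>S. x \<otimes>\<^bsub>G\<^esub> y \<in> S)"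

definition maximal_subsemigroup :: "('a, 'b) monoid_scheme \<Rightarrow> 'a set \<Rightarrow> bool" where
  "maximal_subsemigroup G M \<longleftrightarrow>
     subsemigroup G M \<and> M \<noteq> carrier G \<and>
     (\<forall>S. subsemigroup G S \<and> S \<noteq> carrier G \<and> M \<subseteq> S \<longrightarrow> S = M)"

definition Sym :: "'a set \<Rightarrow> ('a \<rightharpoonup> 'a) set" where
  "Sym X = {f \<in> charts X. dom f = X \<and> ran f = X}"

definition pointwise_stabiliser :: "'a set \<Rightarrow> 'a set \<Rightarrow> ('a \<rightharpoonup> 'a) set" where
  "pointwise_stabiliser X \<Sigma> = {f \<in> Sym X. \<forall>y\<in>\<Sigma>. f y = Some y}"

text \<open>Points of \<open>\<Gamma>\<close> outside \<open>dom f\<close> do not contribute to \<open>\<Gamma>f\<close>.\<close>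

definition chart_image :: "('a \<rightharpoonup> 'a) \<Rightarrow> 'a set \<Rightarrow> 'a set" where
  "chart_image f \<Gamma> = {y. \<exists>x\<in>\<Gamma>. f x = Some y}"

definition defect :: "'a set \<Rightarrow> ('a \<rightharpoonup> 'a) \<Rightarrow> 'a rel" where
  "defect X f = |X - ran f|"

definition collapse :: "'a set \<Rightarrow> ('a \<rightharpoonup> 'a) \<Rightarrow> 'a rel" where
  "collapse X f = |X - dom f|"

definition small_charts :: "'a set \<Rightarrow> ('a \<rightharpoonup> 'a) set" where
  "small_charts X = {f \<in> charts X. |ran f| <o |X|}"

definition semigroup_P :: "'a set \<Rightarrow> 'a set \<Rightarrow> ('a \<rightharpoonup> 'a) set" where
  "semigroup_P X \<Gamma> = {f \<in> charts X. \<not> \<Gamma> \<subseteq> dom f \<or> chart_image f \<Gamma> = \<Gamma>} \<union> small_charts X"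

definition semigroup_P_inv :: "'a set \<Rightarrow> 'a set \<Rightarrow> ('a \<rightharpoonup> 'a) set" where
  "semigroup_P_inv X \<Gamma> = {f \<in> charts X. \<not> \<Gamma> \<subseteq> ran f \<or> chart_image f \<Gamma> = \<Gamma>} \<union> small_charts X"

definition semigroup_Q :: "'a set \<Rightarrow> 'a set \<Rightarrow> ('a \<rightharpoonup> 'a) set" where
  "semigroup_Q X \<Gamma> = {f \<in> charts X. \<not> \<Gamma> \<subseteq> dom f \<or>
                (chart_image f \<Gamma> = \<Gamma> \<and> defect X f <o natLeq) \<or>
                collapse X f =o natLeq}"

definition semigroup_Q_inv :: "'a set \<Rightarrow> 'a set \<Rightarrow> ('a \<rightharpoonup> 'a) set" where
  "semigroup_Q_inv X \<Gamma> = {f \<in> charts X. \<not> \<Gamma> \<subseteq> ran f \<or>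
                    (chart_image f \<Gamma> = \<Gamma> \<and> collapse X f <o natLeq) \<or>
                    defect X f =o natLeq}"

end

theory Submission
  imports Defs
begin

text \<open>
  Maximality of \<open>P\<^sub>\<Gamma>\<close> and \<open>Q\<^sub>\<Gamma>\<close>: for a chart \<open>f\<close> outside the semigroup, some \<open>g\<close> inside makes
  \<open>k = gf\<close> total, in such a way that \<open>k\<^sup>-\<^sup>1h\<close> lies in the semigroup for every chart \<open>h\<close>; then
  \<open>h = k(k\<^sup>-\<^sup>1h)\<close>. Inversion is an anti-automorphism of \<open>I\<^sub>X\<close>, which gives the other two families.

  Conversely, let \<open>M\<close> be maximal, contain the stabiliser but not \<open>Sym(X)\<close>, and be none of the listed
  semigroups. Among the total charts in \<open>M\<close> consider those \<open>f\<close> for which \<open>|im(f) \<inter> \<Sigma>|\<close> is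
  minimal. Composing \<open>f\<close> with elements of the stabiliser and with \<open>q \<in> M\<close> shows that \<open>q\<close> permutes the
  union \<open>\<Gamma>\<close> of the sets \<open>im(f) \<inter> \<Sigma>\<close> whenever \<open>\<Gamma> \<subseteq> dom(q)\<close> and \<open>q\<close> has finite collapse (or, once a
  total chart of infinite defect is available, infinite rank). Since \<open>M\<close> is contained in no \<open>Q\<^sub>\<Gamma>\<close>
  (not even for \<open>\<Gamma> = {}\<close>, when \<open>Q\<^sub>\<Gamma>\<close> is proper and contains \<open>Sym(X)\<close>) and no \<open>P\<^sub>\<Gamma>\<close>, it has a total chart \<open>t\<close> of infinite defect with range disjoint from \<open>\<Sigma>\<close>. Dually it
  contains the inverse of such a chart \<open>s\<close>, and every permutation is \<open>t h s\<^sup>-\<^sup>1\<close> for some \<open>h\<close> in the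
  stabiliser.
\<close>

section \<open>Charts as injective partial maps: pointwise description, images and their
  sizes\<close>

lemma mem_charts_iff:
  "f \<in> charts X \<longleftrightarrow> (\<forall>x y. f x = Some y \<longrightarrow> x \<in> X \<and> y \<in> X) \<and>
     (\<forall>x x' y. f x = Some y \<longrightarrow> f x' = Some y \<longrightarrow> x = x')"
  unfolding charts_def inj_on_def dom_def ran_def by (auto; metis)

lemma chartsD:
  assumes "f \<in> charts X" "f x = Some y"
  shows "x \<in> X" "y \<in> X" "f x' = Some y \<Longrightarrow> x' = x"
  using assms by (auto simp: mem_charts_iff)

lemma charts_dom_ran: "f \<in> charts X \<Longrightarrow> dom f \<subseteq> X" "f \<in> charts X \<Longrightarrow> ran f \<subseteq> X"
  by (auto simp: charts_def)

lemma charts_comp: "f \<in> charts X \<Longrightarrow> g \<in> charts X \<Longrightarrow> g \<circ>\<^sub>m f \<in> charts X"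
  using monoid.m_closed[OF monoid_sym_inv_monoid] by (fastforce simp: sym_inv_monoid_def)

lemma subsemigroup_charts_iff:
  "subsemigroup (sym_inv_monoid X) S \<longleftrightarrow>
     S \<subseteq> charts X \<and> S \<noteq> {} \<and> (\<forall>f\<in>S. \<forall>g\<in>S. g \<circ>\<^sub>m f \<in> S)"
  by (simp add: subsemigroup_def sym_inv_monoid_def)

lemma maximal_subsemigroup_charts_iff:
  "maximal_subsemigroup (sym_inv_monoid X) M \<longleftrightarrow>
     subsemigroup (sym_inv_monoid X) M \<and> M \<noteq> charts X \<and>
     (\<forall>S. subsemigroup (sym_inv_monoid X) S \<longrightarrow> S \<noteq> charts X \<longrightarrow> M \<subseteq> S \<longrightarrow> S = M)"
  by (auto simp: maximal_subsemigroup_def sym_inv_monoid_def)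

lemma bij_betw_chart: "f \<in> charts X \<Longrightarrow> bij_betw (\<lambda>x. the (f x)) (dom f) (ran f)"
  unfolding bij_betw_def inj_on_def by (force simp: mem_charts_iff ran_def image_iff)

lemma finite_ran_iff_dom: "f \<in> charts X \<Longrightarrow> finite (ran f) \<longleftrightarrow> finite (dom f)"
  using bij_betw_chart bij_betw_finite by blast

lemma chart_image_eq: "A \<subseteq> dom f \<Longrightarrow> chart_image f A = (\<lambda>x. the (f x)) ` A"
  by (force simp: chart_image_def image_iff)

lemma chart_image_Int_dom: "chart_image f A = chart_image f (A \<inter> dom f)"
  by (auto simp: chart_image_def)

lemma card_chart_image: "f \<in> charts X \<Longrightarrow> A \<subseteq> dom f \<Longrightarrow> card (chart_image f A) = card A"
  using bij_betw_chart[of f X] inj_on_subset[of "\<lambda>x. the (f x)" "dom f" A]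
  by (simp add: chart_image_eq bij_betw_def card_image)

lemma finite_chart_image: "finite A \<Longrightarrow> finite (chart_image f A)"
  by (subst chart_image_Int_dom) (simp add: chart_image_eq)

text \<open>Points outside the domain contribute nothing, so the image has at most
  \<open>card (A \<inter> dom f)\<close> elements. The clause
  \<open>chart_image f \<Gamma> = \<Gamma>\<close> thus places a finite \<Gamma> inside the domain,
  which the dual semigroups leave implicit.\<close>

lemma chart_image_eq_imp_dom:
  assumes "finite A" "chart_image f A = A"
  shows "A \<subseteq> dom f"
proof -
  have "card A \<le> card (A \<inter> dom f)"
    using assms card_image_le[of "A \<inter> dom f" "\<lambda>x. the (f x)"] chart_image_Int_dom[of f A]
    by (simp add: chart_image_eq)
  with assms(1) have "A \<inter> dom f = A"
    by (intro card_seteq) auto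
  then show ?thesis by blast
qed

lemma chart_image_comp: "chart_image (g \<circ>\<^sub>m f) A = chart_image g (chart_image f A)"
  by (auto simp: chart_image_def map_comp_Some_iff)

section \<open>Inversion as an involution of \<open>charts X\<close> that reverses products\<close>

definition chart_inv :: "('a \<rightharpoonup> 'a) \<Rightarrow> ('a \<rightharpoonup> 'a)" where
  "chart_inv f = (\<lambda>y. if \<exists>x. f x = Some y then Some (SOME x. f x = Some y) else None)"

text \<open>Injectivity leaves \<open>SOME\<close> a single candidate, so \<open>chart_inv\<close>
  is the true inverse on charts.\<close>

lemma chart_inv_eq_Some_iff:
  assumes "f \<in> charts X"
  shows "chart_inv f y = Some x \<longleftrightarrow> f x = Some y"
  unfolding chart_inv_def using chartsD(3)[OF assms]
  by (auto intro: someI dest: someI)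

lemma chart_inv_charts: "f \<in> charts X \<Longrightarrow> chart_inv f \<in> charts X"
  using chart_inv_eq_Some_iff[of f X] unfolding mem_charts_iff[of "chart_inv f"]
  by (auto dest: chartsD)

lemma map_eqI: "(\<And>x y. f x = Some y \<longleftrightarrow> g x = Some y) \<Longrightarrow> f = g"
  by (rule ext) (metis option.exhaust)

lemma chart_inv_chart_inv: "f \<in> charts X \<Longrightarrow> chart_inv (chart_inv f) = f"
  by (rule map_eqI) (simp add: chart_inv_eq_Some_iff[of _ X] chart_inv_charts)

lemma dom_chart_inv: "f \<in> charts X \<Longrightarrow> dom (chart_inv f) = ran f"
  by (auto simp: dom_def ran_def chart_inv_eq_Some_iff)

lemma ran_chart_inv: "f \<in> charts X \<Longrightarrow> ran (chart_inv f) = dom f"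
  by (auto simp: dom_def ran_def chart_inv_eq_Some_iff)

lemma chart_inv_comp:
  "f \<in> charts X \<Longrightarrow> g \<in> charts X \<Longrightarrow> chart_inv (g \<circ>\<^sub>m f) = chart_inv f \<circ>\<^sub>m chart_inv g"
  by (rule map_eqI)
    (auto simp: chart_inv_eq_Some_iff[of _ X] charts_comp map_comp_Some_iff)

text \<open>Finiteness is essential: an infinite \<open>A\<close> may be the image of a proper part
  of itself, and then the inverse carries \<open>A\<close> only onto that part. For finite
  \<open>A\<close> the domain contains \<open>A\<close>, and injectivity gives both
  inclusions.\<close>

lemma chart_image_chart_inv:
  assumes "f \<in> charts X" "finite A"
  shows "chart_image (chart_inv f) A = A \<longleftrightarrow> chart_image f A = A"
proof -
  have *: "chart_image (chart_inv g) A = A" if g: "g \<in> charts X" "chart_image g A = A" for g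
  proof -
    have "x \<in> A" if "y \<in> A" "g x = Some y" for x y
      using that g(2) chartsD(3)[OF g(1)] unfolding chart_image_def by blast
    moreover have "\<exists>y\<in>A. g x = Some y" if "x \<in> A" for x
      using chart_image_eq_imp_dom[OF assms(2) g(2)] that g(2) unfolding chart_image_def by blast
    ultimately show ?thesis
      unfolding chart_image_def chart_inv_eq_Some_iff[OF g(1)] by blast
  qed
  show ?thesis
    using *[of f] *[of "chart_inv f"] assms(1) by (auto simp: chart_inv_chart_inv chart_inv_charts)
qed

lemma image_chart_inv_image: "M \<subseteq> charts X \<Longrightarrow> chart_inv ` chart_inv ` M = M"
  by (force simp: image_image chart_inv_chart_inv subset_iff)

lemma chart_inv_image_charts: "chart_inv ` charts X = charts X"
  using image_chart_inv_image[of "charts X" X] chart_inv_charts[of _ X] by blast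

lemma chart_inv_Sym: "f \<in> Sym X \<Longrightarrow> chart_inv f \<in> Sym X"
  by (simp add: Sym_def chart_inv_charts dom_chart_inv[of _ X] ran_chart_inv[of _ X])

lemma chart_inv_stabiliser:
  "f \<in> pointwise_stabiliser X \<Sigma> \<Longrightarrow> chart_inv f \<in> pointwise_stabiliser X \<Sigma>"
  using chart_inv_Sym[of f X]
  by (auto simp: pointwise_stabiliser_def Sym_def chart_inv_eq_Some_iff[of _ X])

lemma subset_chart_inv_image:
  assumes "A \<subseteq> M" "A \<subseteq> charts X" "\<And>f. f \<in> A \<Longrightarrow> chart_inv f \<in> A"
  shows "A \<subseteq> chart_inv ` M"
proof
  fix f assume "f \<in> A"
  with assms show "f \<in> chart_inv ` M"
    by (intro image_eqI[of _ _ "chart_inv f"]) (auto simp: chart_inv_chart_inv[of _ X] subset_iff)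
qed

lemma subsemigroup_chart_inv:
  assumes "subsemigroup (sym_inv_monoid X) S"
  shows "subsemigroup (sym_inv_monoid X) (chart_inv ` S)"
  using assms unfolding subsemigroup_charts_iff
  by (auto simp: chart_inv_charts subset_iff chart_inv_comp[of _ X, symmetric])

lemma maximal_subsemigroup_chart_inv:
  assumes "maximal_subsemigroup (sym_inv_monoid X) M"
  shows "maximal_subsemigroup (sym_inv_monoid X) (chart_inv ` M)"
proof -
  have M: "subsemigroup (sym_inv_monoid X) M" "M \<noteq> charts X"
    and max: "\<And>S. subsemigroup (sym_inv_monoid X) S \<Longrightarrow> S \<noteq> charts X \<Longrightarrow> M \<subseteq> S \<Longrightarrow> S = M"
    using assms unfolding maximal_subsemigroup_charts_iff by blast+
  then have MX: "M \<subseteq> charts X" by (simp add: subsemigroup_charts_iff)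
  show ?thesis
    unfolding maximal_subsemigroup_charts_iff
  proof (intro conjI allI impI)
    show "subsemigroup (sym_inv_monoid X) (chart_inv ` M)"
      using M(1) by (rule subsemigroup_chart_inv)
    show "chart_inv ` M \<noteq> charts X"
      using M(2) image_chart_inv_image[OF MX] chart_inv_image_charts by metis
  next
    fix S assume S: "subsemigroup (sym_inv_monoid X) S" "S \<noteq> charts X" "chart_inv ` M \<subseteq> S"
    then have SX: "S \<subseteq> charts X" by (simp add: subsemigroup_charts_iff)
    have "chart_inv ` S = M"
    proof (rule max)
      show "subsemigroup (sym_inv_monoid X) (chart_inv ` S)"
        using S(1) by (rule subsemigroup_chart_inv)
      show "chart_inv ` S \<noteq> charts X"
        using S(2) image_chart_inv_image[OF SX] chart_inv_image_charts by metis
      show "M \<subseteq> chart_inv ` S"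
        using S(3) image_chart_inv_image[OF MX] by blast
    qed
    with image_chart_inv_image[OF SX] show "S = chart_inv ` M" by simp
  qed
qed

section \<open>Combinatorial tools: bijections, invariant unions, extension to permutations\<close>

lemma chart_of_bij:
  assumes "bij_betw \<phi> A B" "A \<subseteq> X" "B \<subseteq> X"
  defines "f \<equiv> \<lambda>x. if x \<in> A then Some (\<phi> x) else None"
  shows "f \<in> charts X" "dom f = A" "ran f = B"
  using assms
  by (auto simp: mem_charts_iff f_def ran_def bij_betw_def inj_on_def split: if_splits)

lemma countable_infinite_bij:
  assumes "countable A" "infinite A" "countable B" "infinite B"
  obtains \<phi> where "bij_betw \<phi> A B"
  using bij_betw_trans[OF to_nat_on_infinite[OF assms(1,2)] bij_betw_from_nat_into[OF assms(3,4)]]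
  by blast

text \<open>Since \<open>card\<close> is 0 on infinite sets, its agreement says nothing there; the
  finiteness equivalence separates the cases, and countability settles the infinite one.\<close>

lemma countable_bij:
  assumes "countable A" "countable B" "finite A \<longleftrightarrow> finite B" "card A = card B"
  obtains \<phi> where "bij_betw \<phi> A B"
  using assms countable_infinite_bij[of A B] finite_same_card_bij[of A B] by metis

lemma finite_chart_image_iff:
  "f \<in> charts X \<Longrightarrow> A \<subseteq> dom f \<Longrightarrow> finite (chart_image f A) \<longleftrightarrow> finite A"
  using bij_betw_chart[of f X] inj_on_subset[of "\<lambda>x. the (f x)" "dom f" A]
  by (simp add: chart_image_eq bij_betw_def finite_image_iff)

lemma chart_image_mono: "A \<subseteq> B \<Longrightarrow> chart_image f A \<subseteq> chart_image f B"
  by (auto simp: chart_image_def)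

lemma chart_image_Un: "chart_image f (A \<union> B) = chart_image f A \<union> chart_image f B"
  by (auto simp: chart_image_def)

lemma chart_image_Union: "chart_image f (\<Union>\<A>) = (\<Union>A\<in>\<A>. chart_image f A)"
  by (auto simp: chart_image_def)

text \<open>\<Gamma> is the union of the members of \<A> of least cardinality. A chart in
  \<open>Q\<close> keeps the size of such a member, while \<open>step\<close> puts a member of \<A>
  inside its image; minimality makes the two equal. So \<Gamma> is mapped into itself, and counting
  gives equality.\<close>

lemma ex_invariant_union:
  assumes "finite \<Sigma>" "\<A> \<noteq> {}" "\<And>A. A \<in> \<A> \<Longrightarrow> A \<subseteq> \<Sigma>" and Q: "Q \<subseteq> charts X"
    and step: "\<And>A q. A \<in> \<A> \<Longrightarrow> q \<in> Q \<Longrightarrow> A \<subseteq> dom q \<Longrightarrow> \<exists>B\<in>\<A>. B \<subseteq> chart_image q A"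
  obtains \<Gamma> A where "\<Gamma> \<subseteq> \<Sigma>" "A \<in> \<A>" "A \<subseteq> \<Gamma>" "\<Gamma> = {} \<longrightarrow> A = {}"
    "\<forall>q\<in>Q. \<Gamma> \<subseteq> dom q \<longrightarrow> chart_image q \<Gamma> = \<Gamma>"
proof -
  obtain A where A: "A \<in> \<A>" and min: "\<And>B. B \<in> \<A> \<Longrightarrow> card A \<le> card B"
    using assms(2) ex_has_least_nat[of "\<lambda>A. A \<in> \<A>" _ card] by blast
  define \<G> where "\<G> = {B \<in> \<A>. card B = card A}"
  have fin: "finite (\<Union>\<G>)" "\<Union>\<G> \<subseteq> \<Sigma>"
    using assms(1,3) finite_subset[of "\<Union>\<G>" \<Sigma>] by (auto simp: \<G>_def)
  have "chart_image q (\<Union>\<G>) = \<Union>\<G>" if q: "q \<in> Q" "\<Union>\<G> \<subseteq> dom q" for q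
  proof (rule card_subset_eq[OF fin(1)])
    have "chart_image q B \<in> \<G>" if B: "B \<in> \<G>" for B
    proof -
      have B': "B \<subseteq> dom q" "finite B" using B q(2) fin(1) finite_subset[of B "\<Union>\<G>"] by auto
      then obtain C where C: "C \<in> \<A>" "C \<subseteq> chart_image q B"
        using step[of B q] B q(1) by (auto simp: \<G>_def)
      have card: "card (chart_image q B) = card A"
        using card_chart_image[of q X B] B' B q(1) Q by (auto simp: \<G>_def)
      then have "C = chart_image q B"
        using min[OF C(1)] C(2) card_seteq[OF finite_chart_image[OF B'(2)]] by metis
      with C(1) card show ?thesis by (simp add: \<G>_def)
    qed
    then show "chart_image q (\<Union>\<G>) \<subseteq> \<Union>\<G>" by (auto simp: chart_image_Union)
    show "card (chart_image q (\<Union>\<G>)) = card (\<Union>\<G>)"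
      using q Q by (intro card_chart_image) auto
  qed
  moreover have "A \<subseteq> \<Union>\<G>" using A by (auto simp: \<G>_def)
  moreover from this have "\<Union>\<G> = {} \<longrightarrow> A = {}" by blast
  ultimately show ?thesis using that[OF fin(2) A] by blast
qed

lemma infinite_split:
  assumes "infinite A"
  obtains B where "B \<subseteq> A" "infinite B" "infinite (A - B)"
proof -
  obtain f :: "nat \<Rightarrow> 'a" where f: "inj f" "range f \<subseteq> A"
    using infinite_countable_subset[OF assms] by blast
  have inj: "inj (\<lambda>n. f (2 * n))" "inj (\<lambda>n. f (2 * n + 1))"
    using f(1) by (auto intro!: injI dest!: injD[OF f(1)])
  have *: "f (2 * m + 1) \<noteq> f (2 * n)" for m n
    using f(1) by (simp add: inj_eq) presburger
  have "range (\<lambda>n. f (2 * n + 1)) \<subseteq> A - range (\<lambda>n. f (2 * n))"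
    using f(2) * by (auto simp del: mult_Suc_right)
  then show ?thesis
    using that[of "range (\<lambda>n. f (2 * n))"] f(2) range_inj_infinite[OF inj(1)]
      range_inj_infinite[OF inj(2)] finite_subset by blast
qed

text \<open>Glue \<phi>, \<psi> and the identity of \<Sigma> on three disjoint pieces of
  \<open>X\<close>. The bijection \<psi> is demanded because \<phi> extends to such a permutation
  only if the leftovers match in size.\<close>

lemma stabiliser_extend:
  assumes "\<Sigma> \<subseteq> X" "A \<subseteq> X - \<Sigma>" "B \<subseteq> X - \<Sigma>" "bij_betw \<phi> A B"
    and "bij_betw \<psi> (X - \<Sigma> - A) (X - \<Sigma> - B)"
  obtains h where "h \<in> pointwise_stabiliser X \<Sigma>" "\<And>x. x \<in> A \<Longrightarrow> h x = Some (\<phi> x)"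
proof -
  define \<chi> where "\<chi> x = (if x \<in> A then \<phi> x else if x \<in> \<Sigma> then x else \<psi> x)" for x
  have "bij_betw \<chi> A B"
    using assms(4) by (rule bij_betw_cong[THEN iffD1, rotated]) (simp add: \<chi>_def)
  moreover have "bij_betw \<chi> (X - \<Sigma> - A) (X - \<Sigma> - B)"
    using assms(5) by (rule bij_betw_cong[THEN iffD1, rotated]) (simp add: \<chi>_def)
  moreover have "bij_betw \<chi> \<Sigma> \<Sigma>"
    using bij_betw_id by (rule bij_betw_cong[THEN iffD1, rotated]) (use assms(2) in \<open>auto simp: \<chi>_def\<close>)
  ultimately have "bij_betw \<chi> (A \<union> (X - \<Sigma> - A) \<union> \<Sigma>) (B \<union> (X - \<Sigma> - B) \<union> \<Sigma>)"
    using assms(2,3) by (intro bij_betw_combine) auto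
  moreover have "A \<union> (X - \<Sigma> - A) \<union> \<Sigma> = X" "B \<union> (X - \<Sigma> - B) \<union> \<Sigma> = X"
    using assms(1-3) by auto
  ultimately have "bij_betw \<chi> X X" by simp
  note * = chart_of_bij[OF this order_refl order_refl]
  show ?thesis
  proof
    show "(\<lambda>x. if x \<in> X then Some (\<chi> x) else None) \<in> pointwise_stabiliser X \<Sigma>"
      using * assms(1,2) by (auto simp: pointwise_stabiliser_def Sym_def \<chi>_def)
  qed (use assms(2) in \<open>auto simp: \<chi>_def\<close>)
qed

section \<open>Domain, range, defect and collapse of products; a criterion for maximality\<close>

lemma dom_map_comp_subset: "dom (g \<circ>\<^sub>m f) \<subseteq> dom f"
  by (auto simp: dom_def map_comp_Some_iff)

lemma ran_map_comp_subset: "ran (g \<circ>\<^sub>m f) \<subseteq> ran g"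
  by (auto simp: ran_def map_comp_Some_iff)

lemma chart_image_subset_dom: "A \<subseteq> dom (g \<circ>\<^sub>m f) \<Longrightarrow> chart_image f A \<subseteq> dom g"
  by (force simp: chart_image_def map_comp_Some_iff subset_iff)

lemma finite_defect_comp:
  assumes "f \<in> charts X" "g \<in> charts X" "finite (X - ran f)" "finite (X - ran g)"
  shows "finite (X - ran (g \<circ>\<^sub>m f))"
proof -
  have "X - ran (g \<circ>\<^sub>m f) \<subseteq> (X - ran g) \<union> chart_image g (X - ran f)"
  proof
    fix z assume z: "z \<in> X - ran (g \<circ>\<^sub>m f)"
    show "z \<in> (X - ran g) \<union> chart_image g (X - ran f)"
    proof (cases "z \<in> ran g")
      case True
      then obtain y where y: "g y = Some z" by (auto simp: ran_def)
      moreover have "y \<notin> ran f" using y z by (auto simp: ran_def map_comp_Some_iff)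
      ultimately show ?thesis using chartsD(1)[OF assms(2) y] by (auto simp: chart_image_def)
    qed (use z in blast)
  qed
  then show ?thesis using assms finite_chart_image finite_subset by blast
qed

text \<open>As \<open>f\<close> misses only finitely many points, almost every point outside
  \<open>dom g\<close> is hit by \<open>f\<close>, and its preimage drops out of the domain of the
  product.\<close>

lemma infinite_collapse_comp:
  assumes "f \<in> charts X" "finite (X - ran f)" "infinite (X - dom g)"
  shows "infinite (X - dom (g \<circ>\<^sub>m f))"
proof
  assume fin: "finite (X - dom (g \<circ>\<^sub>m f))"
  have "X - dom g \<subseteq> (X - ran f) \<union> chart_image f (X - dom (g \<circ>\<^sub>m f))"
  proof
    fix y assume y: "y \<in> X - dom g"
    show "y \<in> (X - ran f) \<union> chart_image f (X - dom (g \<circ>\<^sub>m f))"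
    proof (cases "y \<in> ran f")
      case True
      then obtain x where x: "f x = Some y" by (auto simp: ran_def)
      moreover have "x \<notin> dom (g \<circ>\<^sub>m f)" using x y by (auto simp: map_comp_Some_iff)
      ultimately show ?thesis using chartsD(1)[OF assms(1) x] by (auto simp: chart_image_def)
    qed (use y in blast)
  qed
  then show False using fin assms finite_chart_image finite_subset by blast
qed

lemma idmap_stabiliser:
  assumes "\<Sigma> \<subseteq> X"
  shows "(\<lambda>x. if x \<in> X then Some x else None) \<in> pointwise_stabiliser X \<Sigma>"
  using chart_of_bij[OF bij_betw_id[unfolded id_def], of X X] assms
  by (auto simp: pointwise_stabiliser_def Sym_def)

lemma chart_image_stabiliser:
  assumes "f \<in> pointwise_stabiliser X \<Sigma>" "\<Gamma> \<subseteq> \<Sigma>"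
  shows "chart_image f \<Gamma> = \<Gamma>"
proof -
  have "f x = Some x" if "x \<in> \<Gamma>" for x
    using assms that by (auto simp: pointwise_stabiliser_def)
  then show ?thesis by (auto simp: chart_image_def)
qed

text \<open>A semigroup strictly above \<open>M\<close> contains some \<open>f\<close> outside
  \<open>M\<close>, hence the total chart \<open>f \<circ>\<^sub>m g\<close>. A total chart followed
  by its inverse is the identity of \<open>X\<close>, so every chart is this total chart followed by
  an element of \<open>M\<close>.\<close>

lemma maximal_subsemigroupI:
  assumes M: "subsemigroup (sym_inv_monoid X) M" "M \<noteq> charts X"
    and inv: "\<And>f. f \<in> charts X \<Longrightarrow> f \<notin> M \<Longrightarrow>
      \<exists>g\<in>M. dom (f \<circ>\<^sub>m g) = X \<and> (\<forall>h\<in>charts X. h \<circ>\<^sub>m chart_inv (f \<circ>\<^sub>m g) \<in> M)"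
  shows "maximal_subsemigroup (sym_inv_monoid X) M"
  unfolding maximal_subsemigroup_charts_iff
proof (intro conjI allI impI M)
  fix S assume S: "subsemigroup (sym_inv_monoid X) S" "S \<noteq> charts X" "M \<subseteq> S"
  then have SX: "S \<subseteq> charts X" and mult: "\<And>f g. f \<in> S \<Longrightarrow> g \<in> S \<Longrightarrow> g \<circ>\<^sub>m f \<in> S"
    by (auto simp: subsemigroup_charts_iff)
  show "S = M"
  proof (rule ccontr)
    assume "S \<noteq> M"
    then obtain f where f: "f \<in> S" "f \<notin> M" using S by blast
    then obtain g where g: "g \<in> M" "dom (f \<circ>\<^sub>m g) = X"
      and R: "\<And>h. h \<in> charts X \<Longrightarrow> h \<circ>\<^sub>m chart_inv (f \<circ>\<^sub>m g) \<in> M"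
      using inv[of f] SX by blast
    have fg: "f \<circ>\<^sub>m g \<in> charts X" "f \<circ>\<^sub>m g \<in> S" using mult S(3) SX f g by blast+
    have "h \<in> S" if h: "h \<in> charts X" for h
    proof -
      have "(h \<circ>\<^sub>m chart_inv (f \<circ>\<^sub>m g)) \<circ>\<^sub>m (f \<circ>\<^sub>m g) = h"
      proof (rule ext)
        fix x
        show "((h \<circ>\<^sub>m chart_inv (f \<circ>\<^sub>m g)) \<circ>\<^sub>m (f \<circ>\<^sub>m g)) x = h x"
        proof (cases "x \<in> X")
          case True
          with g obtain y where y: "(f \<circ>\<^sub>m g) x = Some y" by blast
          then have "chart_inv (f \<circ>\<^sub>m g) y = Some x" using chart_inv_eq_Some_iff[OF fg(1)] by simp
          then show ?thesis
            using y by (simp add: map_comp_def[of _ "f \<circ>\<^sub>m g"] map_comp_def[of h])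
        next
          case False
          then have "h x = None" "(f \<circ>\<^sub>m g) x = None"
            using h g(2) by (auto simp: charts_def)
          then show ?thesis by (simp add: map_comp_def[of _ "f \<circ>\<^sub>m g"])
        qed
      qed
      then show ?thesis using mult[OF fg(2), of "h \<circ>\<^sub>m chart_inv (f \<circ>\<^sub>m g)"] R[OF h] S(3) by auto
    qed
    with SX S(2) show False by blast
  qed
qed

lemma Sym_subset_charts: "Sym X \<subseteq> charts X"
  by (auto simp: Sym_def)

lemma maximal_not_subset:
  assumes "maximal_subsemigroup (sym_inv_monoid X) M" "\<not> Sym X \<subseteq> M"
    and "subsemigroup (sym_inv_monoid X) S" "S \<noteq> charts X" "Sym X \<subseteq> S"
  shows "\<not> M \<subseteq> S"
  using assms unfolding maximal_subsemigroup_charts_iff by blast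

section \<open>Countably infinite \<open>X\<close>: cardinal conditions become finiteness
  conditions\<close>

locale countable_charts =
  fixes X :: "'a set"
  assumes countable_X: "countable X" and infinite_X: "infinite X"
begin

lemma countable_subset_X: "A \<subseteq> X \<Longrightarrow> countable A"
  using countable_X countable_subset by blast

lemma ex_total_chart_infinite_defect: "\<exists>f\<in>charts X. dom f = X \<and> infinite (X - ran f)"
proof -
  obtain B where B: "B \<subseteq> X" "infinite B" "infinite (X - B)" using infinite_split[OF infinite_X] .
  obtain \<phi> where "bij_betw \<phi> X B"
    using countable_infinite_bij[OF countable_X infinite_X _ B(2)] countable_subset_X[OF B(1)] by blast
  from chart_of_bij[OF this order_refl B(1)] B(3) show ?thesis by blast
qed

text \<open>An infinite subset of \<open>X\<close> is equipotent to \<open>X\<close>, so a rank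
  below \<open>|X|\<close> is finite.\<close>

lemma small_charts_eq: "small_charts X = {f \<in> charts X. finite (dom f)}"
proof -
  have "|ran f| <o |X| \<longleftrightarrow> finite (dom f)" if f: "f \<in> charts X" for f
  proof
    assume "finite (dom f)"
    then show "|ran f| <o |X|"
      using finite_ran_iff_dom[OF f] infinite_X by (intro finite_ordLess_infinite card_of_Well_order) (simp_all add: Field_card_of)
  next
    assume less: "|ran f| <o |X|"
    show "finite (dom f)"
    proof (rule ccontr)
      assume "infinite (dom f)"
      then have "infinite (ran f)" using finite_ran_iff_dom[OF f] by simp
      then obtain \<phi> where "bij_betw \<phi> X (ran f)"
        using countable_infinite_bij[OF countable_X infinite_X] countable_subset_X
          charts_dom_ran(2)[OF f] by metis
      then have "|X| =o |ran f|" using card_of_ordIso by blast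
      with less show False using not_ordLess_ordIso ordIso_symmetric by blast
    qed
  qed
  then show ?thesis by (auto simp: small_charts_def)
qed

lemma defect_less_iff: "defect X f <o natLeq \<longleftrightarrow> finite (X - ran f)"
  by (simp add: defect_def finite_iff_ordLess_natLeq)

lemma collapse_less_iff: "collapse X f <o natLeq \<longleftrightarrow> finite (X - dom f)"
  by (simp add: collapse_def finite_iff_ordLess_natLeq)

text \<open>Countability leaves \<open>natLeq\<close> as the only infinite size, so clauses asking
  for it become plain infinitude.\<close>

lemma card_of_ordIso_natLeq_iff: "|X - A| =o natLeq \<longleftrightarrow> infinite (X - A)"
proof
  show "|X - A| =o natLeq \<Longrightarrow> infinite (X - A)"
    using finite_iff_ordLess_natLeq not_ordLess_ordIso by blast
next
  assume inf: "infinite (X - A)"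
  have "countable (X - A)" by (rule countable_subset_X) blast
  then obtain \<phi> where "bij_betw \<phi> (X - A) (UNIV :: nat set)"
    using inf to_nat_on_infinite by blast
  then have "|X - A| =o |UNIV :: nat set|" using card_of_ordIso by blast
  then show "|X - A| =o natLeq" using card_of_nat ordIso_transitive by blast
qed

lemma semigroup_P_eq: "semigroup_P X \<Gamma> =
    {f \<in> charts X. \<not> \<Gamma> \<subseteq> dom f \<or> chart_image f \<Gamma> = \<Gamma> \<or> finite (dom f)}"
  by (auto simp: semigroup_P_def small_charts_eq)

lemma semigroup_Q_eq: "semigroup_Q X \<Gamma> =
    {f \<in> charts X. \<not> \<Gamma> \<subseteq> dom f \<or> (chart_image f \<Gamma> = \<Gamma> \<and> finite (X - ran f)) \<or> infinite (X - dom f)}"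
  by (auto simp: semigroup_Q_def defect_less_iff collapse_def card_of_ordIso_natLeq_iff)

lemma chart_inv_semigroup_P:
  assumes "finite \<Gamma>"
  shows "chart_inv ` semigroup_P X \<Gamma> = semigroup_P_inv X \<Gamma>"
proof -
  have *: "chart_inv f \<in> semigroup_P X \<Gamma> \<longleftrightarrow> f \<in> semigroup_P_inv X \<Gamma>" if "f \<in> charts X" for f
    using that assms by (auto simp: semigroup_P_eq semigroup_P_inv_def small_charts_eq
        chart_inv_charts dom_chart_inv chart_image_chart_inv finite_ran_iff_dom)
  have **: "semigroup_P X \<Gamma> \<subseteq> charts X" "semigroup_P_inv X \<Gamma> \<subseteq> charts X"
    by (auto simp: semigroup_P_eq semigroup_P_inv_def small_charts_eq)
  show ?thesis
    using * ** chart_inv_chart_inv[of _ X] chart_inv_charts[of _ X]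
    by (force simp: subset_iff image_iff)
qed

lemma chart_inv_semigroup_Q:
  assumes "finite \<Gamma>"
  shows "chart_inv ` semigroup_Q X \<Gamma> = semigroup_Q_inv X \<Gamma>"
proof -
  have *: "chart_inv f \<in> semigroup_Q X \<Gamma> \<longleftrightarrow> f \<in> semigroup_Q_inv X \<Gamma>" if "f \<in> charts X" for f
    using that assms by (auto simp: semigroup_Q_eq semigroup_Q_inv_def collapse_less_iff defect_def
        card_of_ordIso_natLeq_iff chart_inv_charts dom_chart_inv ran_chart_inv chart_image_chart_inv)
  have **: "semigroup_Q X \<Gamma> \<subseteq> charts X" "semigroup_Q_inv X \<Gamma> \<subseteq> charts X"
    by (auto simp: semigroup_Q_eq semigroup_Q_inv_def)
  show ?thesis
    using * ** chart_inv_chart_inv[of _ X] chart_inv_charts[of _ X]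
    by (force simp: subset_iff image_iff)
qed

section \<open>The semigroups \<open>P\<close> and \<open>Q\<close>: closure under products and
  maximality\<close>

lemma stabiliser_subset_P: "\<Gamma> \<subseteq> \<Sigma> \<Longrightarrow> pointwise_stabiliser X \<Sigma> \<subseteq> semigroup_P X \<Gamma>"
  using chart_image_stabiliser[of _ X \<Sigma> \<Gamma>]
  by (auto simp: pointwise_stabiliser_def Sym_def semigroup_P_eq)

lemma stabiliser_subset_Q: "\<Gamma> \<subseteq> \<Sigma> \<Longrightarrow> pointwise_stabiliser X \<Sigma> \<subseteq> semigroup_Q X \<Gamma>"
  using chart_image_stabiliser[of _ X \<Sigma> \<Gamma>]
  by (auto simp: pointwise_stabiliser_def Sym_def semigroup_Q_eq)

text \<open>Only a product with infinite domain containing \<Gamma> needs an argument. Its domain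
  and range are infinite, so both factors have infinite domain; hence \<open>f\<close> preserves
  \<Gamma>, and then \<Gamma> lies in \<open>dom g\<close> and \<open>g\<close> preserves it
  too.\<close>

lemma subsemigroup_P:
  assumes "\<Gamma> \<subseteq> X"
  shows "subsemigroup (sym_inv_monoid X) (semigroup_P X \<Gamma>)"
  unfolding subsemigroup_charts_iff
proof (intro conjI ballI)
  show "semigroup_P X \<Gamma> \<noteq> {}"
    using subsetD[OF stabiliser_subset_P[OF order_refl] idmap_stabiliser[OF assms]] by auto
  fix f g assume f: "f \<in> semigroup_P X \<Gamma>" and g: "g \<in> semigroup_P X \<Gamma>"
  show "g \<circ>\<^sub>m f \<in> semigroup_P X \<Gamma>"
  proof (cases "\<Gamma> \<subseteq> dom (g \<circ>\<^sub>m f) \<and> infinite (dom (g \<circ>\<^sub>m f))")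
    case False
    then show ?thesis using f g by (auto simp: semigroup_P_eq charts_comp)
  next
    case True
    then have "\<Gamma> \<subseteq> dom f" "infinite (dom f)"
      using dom_map_comp_subset[of g f] finite_subset by blast+
    with f have im: "chart_image f \<Gamma> = \<Gamma>" by (auto simp: semigroup_P_eq)
    have "infinite (ran (g \<circ>\<^sub>m f))"
      using True f g by (subst finite_ran_iff_dom[of _ X]) (auto simp: semigroup_P_eq charts_comp)
    then have "infinite (dom g)"
      using g ran_map_comp_subset[of g f] finite_subset finite_ran_iff_dom[of g X]
      by (auto simp: semigroup_P_eq)
    moreover have "\<Gamma> \<subseteq> dom g" using chart_image_subset_dom True im by blast
    ultimately have "chart_image g \<Gamma> = \<Gamma>" using g by (auto simp: semigroup_P_eq)
    with im f g show ?thesis by (auto simp: semigroup_P_eq charts_comp chart_image_comp)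
  qed
qed (auto simp: semigroup_P_eq)

text \<open>Finite collapse of the product passes to \<open>f\<close>, whose defect is then finite.
  This lets \<open>infinite_collapse_comp\<close> transfer finite collapse to \<open>g\<close>, and
  explains why \<open>Q\<close> bounds the defect alongside the condition on \<Gamma>.\<close>

lemma subsemigroup_Q:
  assumes "\<Gamma> \<subseteq> X"
  shows "subsemigroup (sym_inv_monoid X) (semigroup_Q X \<Gamma>)"
  unfolding subsemigroup_charts_iff
proof (intro conjI ballI)
  show "semigroup_Q X \<Gamma> \<noteq> {}"
    using subsetD[OF stabiliser_subset_Q[OF order_refl] idmap_stabiliser[OF assms]] by auto
  fix f g assume f: "f \<in> semigroup_Q X \<Gamma>" and g: "g \<in> semigroup_Q X \<Gamma>"
  show "g \<circ>\<^sub>m f \<in> semigroup_Q X \<Gamma>"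
  proof (cases "\<Gamma> \<subseteq> dom (g \<circ>\<^sub>m f) \<and> finite (X - dom (g \<circ>\<^sub>m f))")
    case False
    then show ?thesis using f g by (auto simp: semigroup_Q_eq charts_comp)
  next
    case True
    then have "\<Gamma> \<subseteq> dom f" "finite (X - dom f)"
      using dom_map_comp_subset[of g f] Diff_mono[OF order_refl, of "dom (g \<circ>\<^sub>m f)" "dom f" X]
        finite_subset by blast+
    with f have im: "chart_image f \<Gamma> = \<Gamma>" "finite (X - ran f)" by (auto simp: semigroup_Q_eq)
    then have "finite (X - dom g)"
      using infinite_collapse_comp[of f X g] f True by (auto simp: semigroup_Q_eq)
    moreover have "\<Gamma> \<subseteq> dom g" using chart_image_subset_dom True im by blast
    ultimately have "chart_image g \<Gamma> = \<Gamma>" "finite (X - ran g)" using g by (auto simp: semigroup_Q_eq)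
    with im f g show ?thesis
      by (auto simp: semigroup_Q_eq charts_comp chart_image_comp finite_defect_comp)
  qed
qed (auto simp: semigroup_Q_eq)

text \<open>Deleting from \<open>dom f\<close> the points outside \<open>\<Gamma>\<close> which \<open>f\<close> sends into \<open>\<Gamma>\<close> ensures that the
  range of the resulting total chart meets \<open>\<Gamma>\<close> only in \<open>\<Gamma>f \<inter> \<Gamma>\<close>.\<close>

lemma totalise:
  assumes f: "f \<in> charts X" and \<Gamma>: "finite \<Gamma>" "\<Gamma> \<subseteq> dom f" and inf: "infinite (dom f)"
  obtains g where "g \<in> charts X" "dom g = X" "chart_image g \<Gamma> = \<Gamma>"
    "dom (f \<circ>\<^sub>m g) = X" "ran (f \<circ>\<^sub>m g) \<inter> \<Gamma> \<subseteq> chart_image f \<Gamma>"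
    "finite (X - dom f) \<Longrightarrow> finite (X - ran g)"
proof -
  define E where "E = chart_image (chart_inv f) \<Gamma> - \<Gamma>"
  define D where "D = dom f - E"
  have E: "finite E" unfolding E_def using \<Gamma>(1) finite_chart_image by blast
  have D: "infinite D" "D \<subseteq> X" "\<Gamma> \<subseteq> D" "D \<subseteq> dom f"
    using E inf charts_dom_ran[OF f] \<Gamma>(2) by (auto simp: D_def E_def)
  have "infinite (X - \<Gamma>)" "infinite (D - \<Gamma>)" "countable (X - \<Gamma>)" "countable (D - \<Gamma>)"
    using infinite_X D \<Gamma>(1) countable_subset_X by auto
  then obtain \<phi> where \<phi>: "bij_betw \<phi> (X - \<Gamma>) (D - \<Gamma>)" using countable_infinite_bij by metis
  define \<chi> where "\<chi> x = (if x \<in> \<Gamma> then x else \<phi> x)" for x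
  have "bij_betw \<chi> (X - \<Gamma>) (D - \<Gamma>)"
    using \<phi> by (rule bij_betw_cong[THEN iffD1, rotated]) (simp add: \<chi>_def)
  moreover have "bij_betw \<chi> \<Gamma> \<Gamma>"
    using bij_betw_id by (rule bij_betw_cong[THEN iffD1, rotated]) (simp add: \<chi>_def)
  ultimately have "bij_betw \<chi> ((X - \<Gamma>) \<union> \<Gamma>) ((D - \<Gamma>) \<union> \<Gamma>)"
    by (intro bij_betw_combine) auto
  moreover have "(X - \<Gamma>) \<union> \<Gamma> = X" "(D - \<Gamma>) \<union> \<Gamma> = D" using D by auto
  ultimately have bij: "bij_betw \<chi> X D" by simp
  define g where "g = (\<lambda>x. if x \<in> X then Some (\<chi> x) else None)"
  have g: "g \<in> charts X" "dom g = X" "ran g = D"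
    using chart_of_bij[OF bij order_refl D(2)] by (simp_all add: g_def)
  show ?thesis
  proof
    show "g \<in> charts X" "dom g = X" by fact+
    show "chart_image g \<Gamma> = \<Gamma>"
      using D by (auto simp: chart_image_def g_def \<chi>_def split: if_splits)
    show "dom (f \<circ>\<^sub>m g) = X"
    proof
      show "dom (f \<circ>\<^sub>m g) \<subseteq> X" using dom_map_comp_subset[of f g] g by simp
      show "X \<subseteq> dom (f \<circ>\<^sub>m g)"
      proof
        fix x assume "x \<in> X"
        then obtain y where "g x = Some y" "y \<in> D" using g by (metis domD ranI)
        with D(4) show "x \<in> dom (f \<circ>\<^sub>m g)" by (auto simp: dom_def map_comp_Some_iff)
      qed
    qed
    show "ran (f \<circ>\<^sub>m g) \<inter> \<Gamma> \<subseteq> chart_image f \<Gamma>"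
    proof
      fix z assume z: "z \<in> ran (f \<circ>\<^sub>m g) \<inter> \<Gamma>"
      then obtain x y where xy: "g x = Some y" "f y = Some z"
        by (auto simp: ran_def map_comp_Some_iff)
      then have "y \<in> D" using g by (auto simp: ran_def)
      with xy z have "y \<in> \<Gamma>"
        by (auto simp: D_def E_def chart_image_def chart_inv_eq_Some_iff[OF f])
      with xy show "z \<in> chart_image f \<Gamma>" by (auto simp: chart_image_def)
    qed
    assume "finite (X - dom f)"
    moreover have "X - D \<subseteq> (X - dom f) \<union> E" by (auto simp: D_def)
    ultimately show "finite (X - ran g)" using E g(3) finite_subset by auto
  qed
qed

lemma ex_Sym_moving:
  assumes "finite \<Gamma>" "\<Gamma> \<subseteq> X" "\<Gamma> \<noteq> {}"
  obtains f where "f \<in> Sym X" "chart_image f \<Gamma> \<noteq> \<Gamma>"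
proof -
  obtain x where x: "x \<in> \<Gamma>" using assms by blast
  obtain y where y: "y \<in> X" "y \<notin> \<Gamma>" using assms infinite_X by (meson finite_subset subsetI)
  define \<phi> where "\<phi> z = (if z = x then y else if z = y then x else z)" for z
  have "bij_betw \<phi> X X"
    by (rule bij_betw_byWitness[of _ \<phi>]) (use x y assms in \<open>auto simp: \<phi>_def\<close>)
  note * = chart_of_bij[OF this order_refl order_refl]
  show ?thesis
  proof
    show "(\<lambda>x. if x \<in> X then Some (\<phi> x) else None) \<in> Sym X" using * by (simp add: Sym_def)
    have "y \<in> chart_image (\<lambda>x. if x \<in> X then Some (\<phi> x) else None) \<Gamma>"
      using x assms by (auto simp: chart_image_def \<phi>_def intro!: bexI[of _ x])
    with y show "chart_image (\<lambda>x. if x \<in> X then Some (\<phi> x) else None) \<Gamma> \<noteq> \<Gamma>" by metis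
  qed
qed

lemma not_Sym_subset:
  assumes "finite \<Gamma>" "\<Gamma> \<subseteq> X" "\<Gamma> \<noteq> {}"
  shows "\<not> Sym X \<subseteq> semigroup_P X \<Gamma>" "\<not> Sym X \<subseteq> semigroup_Q X \<Gamma>"
proof -
  obtain f where "f \<in> Sym X" "chart_image f \<Gamma> \<noteq> \<Gamma>" using ex_Sym_moving[OF assms] .
  then have "f \<in> Sym X" "f \<notin> semigroup_P X \<Gamma>" "f \<notin> semigroup_Q X \<Gamma>"
    using assms infinite_X by (auto simp: Sym_def semigroup_P_eq semigroup_Q_eq)
  then show "\<not> Sym X \<subseteq> semigroup_P X \<Gamma>" "\<not> Sym X \<subseteq> semigroup_Q X \<Gamma>" by blast+
qed

lemma maximal_P:
  assumes \<Gamma>: "finite \<Gamma>" "\<Gamma> \<subseteq> X" "\<Gamma> \<noteq> {}"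
  shows "maximal_subsemigroup (sym_inv_monoid X) (semigroup_P X \<Gamma>)"
proof (rule maximal_subsemigroupI[OF subsemigroup_P[OF \<Gamma>(2)]])
  show "semigroup_P X \<Gamma> \<noteq> charts X" using not_Sym_subset(1)[OF \<Gamma>] Sym_subset_charts by blast
  fix f assume f: "f \<in> charts X" "f \<notin> semigroup_P X \<Gamma>"
  then have f': "\<Gamma> \<subseteq> dom f" "chart_image f \<Gamma> \<noteq> \<Gamma>" "infinite (dom f)" by (auto simp: semigroup_P_eq)
  obtain g where g: "g \<in> charts X" "dom g = X" "chart_image g \<Gamma> = \<Gamma>"
    "dom (f \<circ>\<^sub>m g) = X" "ran (f \<circ>\<^sub>m g) \<inter> \<Gamma> \<subseteq> chart_image f \<Gamma>"
    using totalise[OF f(1) \<Gamma>(1) f'(1,3)] by metis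
  \<comment> \<open>The image has as many elements as \<Gamma>, so being different it misses a point
    of \<Gamma>.\<close>
  have "\<not> \<Gamma> \<subseteq> chart_image f \<Gamma>"
    using f'(2) card_subset_eq[OF finite_chart_image[OF \<Gamma>(1)]] card_chart_image[OF f(1) f'(1)]
    by metis
  then have ran: "\<not> \<Gamma> \<subseteq> ran (f \<circ>\<^sub>m g)" using g(5) by blast
  have fg: "f \<circ>\<^sub>m g \<in> charts X" using charts_comp f g by blast
  \<comment> \<open>Whatever \<open>h\<close> is, the domain of this product lies in the range of
    \<open>f \<circ>\<^sub>m g\<close> and so misses a point of \<Gamma>.\<close>
  have "h \<circ>\<^sub>m chart_inv (f \<circ>\<^sub>m g) \<in> semigroup_P X \<Gamma>" if "h \<in> charts X" for h
    using ran dom_map_comp_subset[of h "chart_inv (f \<circ>\<^sub>m g)"] dom_chart_inv[OF fg]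
      charts_comp[OF chart_inv_charts[OF fg] that] unfolding semigroup_P_eq by blast
  moreover have "g \<in> semigroup_P X \<Gamma>" using g by (simp add: semigroup_P_eq)
  ultimately show "\<exists>g\<in>semigroup_P X \<Gamma>. dom (f \<circ>\<^sub>m g) = X \<and>
      (\<forall>h\<in>charts X. h \<circ>\<^sub>m chart_inv (f \<circ>\<^sub>m g) \<in> semigroup_P X \<Gamma>)"
    using g(4) by blast
qed

lemma maximal_Q:
  assumes \<Gamma>: "finite \<Gamma>" "\<Gamma> \<subseteq> X" "\<Gamma> \<noteq> {}"
  shows "maximal_subsemigroup (sym_inv_monoid X) (semigroup_Q X \<Gamma>)"
proof (rule maximal_subsemigroupI[OF subsemigroup_Q[OF \<Gamma>(2)]])
  show "semigroup_Q X \<Gamma> \<noteq> charts X" using not_Sym_subset(2)[OF \<Gamma>] Sym_subset_charts by blast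
  fix f assume f: "f \<in> charts X" "f \<notin> semigroup_Q X \<Gamma>"
  then have f': "\<Gamma> \<subseteq> dom f" "chart_image f \<Gamma> \<noteq> \<Gamma> \<or> infinite (X - ran f)" "finite (X - dom f)"
    by (auto simp: semigroup_Q_eq)
  then have "infinite (dom f)" using infinite_X by (metis finite_Diff2)
  \<comment> \<open>Finite collapse of \<open>f\<close> makes the defect of \<open>g\<close> finite,
    as \<open>Q\<close> requires of a total chart.\<close>
  then obtain g where g: "g \<in> charts X" "dom g = X" "chart_image g \<Gamma> = \<Gamma>"
    "dom (f \<circ>\<^sub>m g) = X" "ran (f \<circ>\<^sub>m g) \<inter> \<Gamma> \<subseteq> chart_image f \<Gamma>" "finite (X - ran g)"
    using totalise[OF f(1) \<Gamma>(1) f'(1)] f'(3) by metis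
  have fg: "f \<circ>\<^sub>m g \<in> charts X" using charts_comp f g by blast
  \<comment> \<open>The two ways in which \<open>f\<close> fails to be in \<open>Q\<close>: moving
    \<Gamma> gives a missed point of \<Gamma>, and infinite defect gives infinite collapse to
    everything that begins with the inverse of \<open>f \<circ>\<^sub>m g\<close>.\<close>
  have ran: "\<not> \<Gamma> \<subseteq> ran (f \<circ>\<^sub>m g) \<or> infinite (X - ran (f \<circ>\<^sub>m g))"
    using f'(2)
  proof
    assume "chart_image f \<Gamma> \<noteq> \<Gamma>"
    then have "\<not> \<Gamma> \<subseteq> chart_image f \<Gamma>"
      using card_subset_eq[OF finite_chart_image[OF \<Gamma>(1)]] card_chart_image[OF f(1) f'(1)] by metis
    then show ?thesis using g(5) by blast
  next
    assume "infinite (X - ran f)"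
    moreover have "X - ran f \<subseteq> X - ran (f \<circ>\<^sub>m g)" using ran_map_comp_subset[of f g] by blast
    ultimately show ?thesis using finite_subset by blast
  qed
  have "h \<circ>\<^sub>m chart_inv (f \<circ>\<^sub>m g) \<in> semigroup_Q X \<Gamma>" if h: "h \<in> charts X" for h
  proof -
    have "dom (h \<circ>\<^sub>m chart_inv (f \<circ>\<^sub>m g)) \<subseteq> ran (f \<circ>\<^sub>m g)"
      using dom_map_comp_subset[of h "chart_inv (f \<circ>\<^sub>m g)"] dom_chart_inv[OF fg] by simp
    then have "\<not> \<Gamma> \<subseteq> dom (h \<circ>\<^sub>m chart_inv (f \<circ>\<^sub>m g)) \<or> infinite (X - dom (h \<circ>\<^sub>m chart_inv (f \<circ>\<^sub>m g)))"
      using ran finite_subset[OF Diff_mono[OF order_refl]] by blast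
    then show ?thesis using charts_comp[OF chart_inv_charts[OF fg] h] by (auto simp: semigroup_Q_eq)
  qed
  moreover have "g \<in> semigroup_Q X \<Gamma>" using g by (simp add: semigroup_Q_eq)
  ultimately show "\<exists>g\<in>semigroup_Q X \<Gamma>. dom (f \<circ>\<^sub>m g) = X \<and>
      (\<forall>h\<in>charts X. h \<circ>\<^sub>m chart_inv (f \<circ>\<^sub>m g) \<in> semigroup_Q X \<Gamma>)"
    using g(4) by blast
qed

end

section \<open>Steering total charts inside a semigroup that contains the stabiliser\<close>

locale stabiliser_semigroup = countable_charts +
  fixes \<Sigma> :: "'a set" and M :: "('a \<rightharpoonup> 'a) set"
  assumes finite_\<Sigma>: "finite \<Sigma>" and \<Sigma>_subset: "\<Sigma> \<subseteq> X"
    and M_charts: "M \<subseteq> charts X" and M_mult: "f \<in> M \<Longrightarrow> g \<in> M \<Longrightarrow> g \<circ>\<^sub>m f \<in> M"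
    and stabiliser_M: "pointwise_stabiliser X \<Sigma> \<subseteq> M"
begin

lemma total_comp:
  assumes "F \<in> charts X" "dom F = X" "ran F \<subseteq> dom g"
  shows "dom (g \<circ>\<^sub>m F) = X"
proof
  show "dom (g \<circ>\<^sub>m F) \<subseteq> X" using dom_map_comp_subset[of g F] assms(2) by simp
  show "X \<subseteq> dom (g \<circ>\<^sub>m F)"
  proof
    fix x assume "x \<in> X"
    then obtain y where "F x = Some y" using assms(2) by blast
    moreover from this have "y \<in> dom g" using assms(3) by (auto simp: ran_def)
    ultimately show "x \<in> dom (g \<circ>\<^sub>m F)" by auto
  qed
qed

lemma infinite_ran_diff: "F \<in> charts X \<Longrightarrow> dom F = X \<Longrightarrow> infinite (ran F - \<Sigma>)"
  using finite_ran_iff_dom[of F X] infinite_X finite_\<Sigma> by simp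

text \<open>Some \<open>h\<close> in the stabiliser carries \<open>ran F - \<Sigma>\<close> onto
  \<open>C\<close>: by \<open>size\<close> the complements of these sets in
  \<open>X - \<Sigma>\<close> are equipotent. Take \<open>K\<close> to be \<open>F\<close>, then
  \<open>h\<close>, then \<open>q\<close>. Since \<open>q\<close> keeps \<open>C\<close> off
  \<Sigma>, the range of \<open>K\<close> meets \<Sigma> only in images of points of
  \<open>ran F \<inter> \<Sigma>\<close>.\<close>

lemma push_total:
  assumes F: "F \<in> M" "dom F = X" and q: "q \<in> M" "ran F \<inter> \<Sigma> \<subseteq> dom q"
    and C: "C \<subseteq> dom q - \<Sigma>" "chart_image q C \<inter> \<Sigma> = {}" "infinite C"
    and size: "finite (X - \<Sigma> - ran F) \<longleftrightarrow> finite (X - \<Sigma> - C)" "card (X - \<Sigma> - ran F) = card (X - \<Sigma> - C)"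
  obtains K where "K \<in> M" "dom K = X" "ran K \<subseteq> chart_image q ((ran F \<inter> \<Sigma>) \<union> C)"
    "ran K \<inter> \<Sigma> \<subseteq> chart_image q (ran F \<inter> \<Sigma>)"
proof -
  have Fc: "F \<in> charts X" and qc: "q \<in> charts X" using F q M_charts by auto
  have sub: "ran F - \<Sigma> \<subseteq> X - \<Sigma>" "C \<subseteq> X - \<Sigma>"
    using charts_dom_ran(2)[OF Fc] charts_dom_ran(1)[OF qc] C(1) by auto
  have eq: "X - \<Sigma> - (ran F - \<Sigma>) = X - \<Sigma> - ran F" by blast
  obtain \<phi> where \<phi>: "bij_betw \<phi> (ran F - \<Sigma>) C"
    using countable_infinite_bij[OF _ infinite_ran_diff[OF Fc F(2)] _ C(3)] sub countable_subset_X
    by (metis Diff_subset subset_trans)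
  obtain \<psi> where "bij_betw \<psi> (X - \<Sigma> - ran F) (X - \<Sigma> - C)"
    using countable_bij[OF _ _ size] countable_subset_X by (metis Diff_subset subset_trans)
  then obtain h where h: "h \<in> pointwise_stabiliser X \<Sigma>" "\<And>x. x \<in> ran F - \<Sigma> \<Longrightarrow> h x = Some (\<phi> x)"
    using stabiliser_extend[OF \<Sigma>_subset sub \<phi>] unfolding eq by metis
  then have hM: "h \<in> M" and hfix: "\<And>x. x \<in> \<Sigma> \<Longrightarrow> h x = Some x" and "dom h = X"
    using stabiliser_M by (auto simp: pointwise_stabiliser_def Sym_def)
  have hF: "h \<circ>\<^sub>m F \<in> M" using M_mult F hM by blast
  have dom: "dom (h \<circ>\<^sub>m F) = X"
    using charts_dom_ran(2)[OF Fc] \<open>dom h = X\<close> by (intro total_comp[OF Fc F(2)]) simp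
  have ran: "ran (h \<circ>\<^sub>m F) \<subseteq> (ran F \<inter> \<Sigma>) \<union> C"
  proof
    fix z assume "z \<in> ran (h \<circ>\<^sub>m F)"
    then obtain y where "y \<in> ran F" "h y = Some z" by (auto simp: ran_def map_comp_Some_iff)
    then show "z \<in> (ran F \<inter> \<Sigma>) \<union> C"
      using h(2)[of y] hfix[of y] bij_betwE[OF \<phi>] by (cases "y \<in> \<Sigma>") auto
  qed
  have ranK: "ran (q \<circ>\<^sub>m (h \<circ>\<^sub>m F)) \<subseteq> chart_image q ((ran F \<inter> \<Sigma>) \<union> C)"
    using ran by (auto simp: ran_def chart_image_def map_comp_Some_iff)
  show ?thesis
  proof
    show "q \<circ>\<^sub>m (h \<circ>\<^sub>m F) \<in> M" using M_mult hF q by blast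
    show "dom (q \<circ>\<^sub>m (h \<circ>\<^sub>m F)) = X"
      using total_comp[of "h \<circ>\<^sub>m F" q] hF M_charts dom ran C(1) q(2) by blast
    show "ran (q \<circ>\<^sub>m (h \<circ>\<^sub>m F)) \<subseteq> chart_image q ((ran F \<inter> \<Sigma>) \<union> C)" by (rule ranK)
    show "ran (q \<circ>\<^sub>m (h \<circ>\<^sub>m F)) \<inter> \<Sigma> \<subseteq> chart_image q (ran F \<inter> \<Sigma>)"
      using ranK C(2) chart_image_Un[of q] by blast
  qed
qed

text \<open>For a chart \<open>q\<close>, the largest candidate for \<open>C\<close> in
  \<open>push_total\<close>. As \<Sigma> is finite, it contains all but finitely many points of
  \<open>dom q\<close>.\<close>

definition avoiding :: "('a \<rightharpoonup> 'a) \<Rightarrow> 'a set" where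
  "avoiding q = dom q - \<Sigma> - chart_image (chart_inv q) \<Sigma>"

lemma avoiding_subset: "avoiding q \<subseteq> dom q - \<Sigma>"
  by (auto simp: avoiding_def)

lemma chart_image_avoiding: "q \<in> charts X \<Longrightarrow> A \<subseteq> avoiding q \<Longrightarrow> chart_image q A \<inter> \<Sigma> = {}"
  by (auto simp: avoiding_def chart_image_def chart_inv_eq_Some_iff)

lemma finite_dom_diff_avoiding: "finite (dom q - avoiding q)"
proof -
  have "dom q - avoiding q \<subseteq> \<Sigma> \<union> chart_image (chart_inv q) \<Sigma>" by (auto simp: avoiding_def)
  then show ?thesis using finite_\<Sigma> finite_chart_image finite_subset by blast
qed

lemma infinite_avoiding: "infinite (dom q) \<Longrightarrow> infinite (avoiding q)"
  using finite_dom_diff_avoiding[of q] by (metis finite_Diff2)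

text \<open>An infinite part of \<open>avoiding q\<close> is kept out of \<open>C\<close>. This
  makes the complement of \<open>C\<close> infinite, matching that of \<open>ran F\<close>, and the
  image of this part under \<open>q\<close> is missed by \<open>K\<close>, so the new defect is
  infinite again.\<close>

lemma push_infinite_defect:
  assumes F: "F \<in> M" "dom F = X" "infinite (X - ran F)"
    and q: "q \<in> M" "ran F \<inter> \<Sigma> \<subseteq> dom q" "infinite (dom q)"
  obtains K where "K \<in> M" "dom K = X" "infinite (X - ran K)"
    "ran K \<inter> \<Sigma> \<subseteq> chart_image q (ran F \<inter> \<Sigma>)"
proof -
  have qc: "q \<in> charts X" using q M_charts by auto
  obtain C where C: "C \<subseteq> avoiding q" "infinite C" "infinite (avoiding q - C)"
    using infinite_split[OF infinite_avoiding[OF q(3)]] .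
  have "avoiding q - C \<subseteq> X - \<Sigma> - C" using avoiding_subset charts_dom_ran(1)[OF qc] by blast
  then have inf: "infinite (X - \<Sigma> - C)" using C(3) by (rule infinite_super)
  have "X - \<Sigma> - ran F = (X - ran F) - \<Sigma>" by blast
  then have "infinite (X - \<Sigma> - ran F)" using F(3) finite_\<Sigma> by simp
  with inf have "finite (X - \<Sigma> - ran F) \<longleftrightarrow> finite (X - \<Sigma> - C)"
    "card (X - \<Sigma> - ran F) = card (X - \<Sigma> - C)" by simp_all
  moreover have "C \<subseteq> dom q - \<Sigma>" using C(1) avoiding_subset by blast
  ultimately obtain K where K: "K \<in> M" "dom K = X" "ran K \<subseteq> chart_image q ((ran F \<inter> \<Sigma>) \<union> C)"
    "ran K \<inter> \<Sigma> \<subseteq> chart_image q (ran F \<inter> \<Sigma>)"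
    using push_total[OF F(1,2) q(1,2) _ chart_image_avoiding[OF qc C(1)] C(2)] by metis
  have "chart_image q (avoiding q - C) \<subseteq> X - ran K"
  proof
    fix z assume "z \<in> chart_image q (avoiding q - C)"
    then obtain y where y: "y \<in> avoiding q" "y \<notin> C" "q y = Some z" by (auto simp: chart_image_def)
    have "z \<notin> chart_image q ((ran F \<inter> \<Sigma>) \<union> C)"
    proof
      assume "z \<in> chart_image q ((ran F \<inter> \<Sigma>) \<union> C)"
      then obtain x where "x \<in> (ran F \<inter> \<Sigma>) \<union> C" "q x = Some z" by (auto simp: chart_image_def)
      moreover from this have "x = y" using chartsD(3)[OF qc y(3)] by blast
      ultimately show False using y avoiding_subset[of q] by blast
    qed
    with K(3) chartsD(2)[OF qc y(3)] show "z \<in> X - ran K" by blast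
  qed
  moreover have "infinite (chart_image q (avoiding q - C))"
    using C(3) finite_chart_image_iff[OF qc, of "avoiding q - C"] avoiding_subset by blast
  ultimately have "infinite (X - ran K)" using finite_subset by blast
  with K that show ?thesis by blast
qed

text \<open>Composing on the left with a total chart that misses a point strictly shrinks the range.\<close>

lemma total_large_defect:
  assumes F: "F \<in> M" "dom F = X" and a: "a \<in> M" "dom a = X" "ran a \<noteq> X"
    and fin: "\<And>f. f \<in> M \<Longrightarrow> dom f = X \<Longrightarrow> finite (X - ran f)"
  shows "\<exists>F'\<in>M. dom F' = X \<and> ran F' \<subseteq> ran F \<and> n \<le> card (X - ran F')"
proof (induction n)
  case 0
  then show ?case using F by blast
next
  case (Suc n)
  then obtain F' where F': "F' \<in> M" "dom F' = X" "ran F' \<subseteq> ran F" "n \<le> card (X - ran F')" by blast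
  have ac: "a \<in> charts X" and Fc: "F' \<in> charts X" using a F' M_charts by auto
  have M: "F' \<circ>\<^sub>m a \<in> M" using M_mult a F' by blast
  have dom: "dom (F' \<circ>\<^sub>m a) = X"
    using charts_dom_ran(2)[OF ac] F'(2) by (intro total_comp[OF ac a(2)]) simp
  obtain y where y: "y \<in> X" "y \<notin> ran a" using a charts_dom_ran(2)[OF ac] by blast
  then obtain z where z: "F' y = Some z" using F'(2) by blast
  have "z \<notin> ran (F' \<circ>\<^sub>m a)"
    using y(2) chartsD(3)[OF Fc z] by (fastforce simp: ran_def map_comp_Some_iff)
  moreover have "z \<in> ran F'" "z \<in> X" using z chartsD(2)[OF Fc z] by (auto simp: ran_def)
  ultimately have "X - ran F' \<subset> X - ran (F' \<circ>\<^sub>m a)"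
    using ran_map_comp_subset[of F' a] by blast
  \<comment> \<open>\<open>fin\<close> keeps these complements finite, where \<open>card\<close>
    reflects strict inclusion.\<close>
  then have "card (X - ran F') < card (X - ran (F' \<circ>\<^sub>m a))"
    using fin[OF M dom] psubset_card_mono by blast
  then show ?case
    using M dom F'(3,4) ran_map_comp_subset[of F' a] by (intro bexI[OF _ M]) auto
qed

text \<open>By \<open>fin\<close> all complements are finite, so the sizes in
  \<open>push_total\<close> must agree exactly. The defect of \<open>F\<close> is first enlarged
  past the complement of \<open>avoiding q\<close>; a finite set \<open>B\<close> is then deleted
  from \<open>avoiding q\<close> to make up the difference.\<close>

lemma push_finite_collapse:
  assumes F: "F \<in> M" "dom F = X" and q: "q \<in> M" "ran F \<inter> \<Sigma> \<subseteq> dom q" "finite (X - dom q)"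
    and a: "a \<in> M" "dom a = X" "ran a \<noteq> X"
    and fin: "\<And>f. f \<in> M \<Longrightarrow> dom f = X \<Longrightarrow> finite (X - ran f)"
  obtains K where "K \<in> M" "dom K = X" "ran K \<subseteq> ran q" "ran K \<inter> \<Sigma> \<subseteq> chart_image q (ran F \<inter> \<Sigma>)"
proof -
  have qc: "q \<in> charts X" using q M_charts by auto
  let ?D = "X - \<Sigma> - avoiding q"
  have finD: "finite ?D"
  proof (rule finite_subset)
    show "?D \<subseteq> (X - dom q) \<union> (dom q - avoiding q)" by blast
  qed (use q(3) finite_dom_diff_avoiding in blast)
  \<comment> \<open>The surplus \<open>card \<Sigma>\<close> allows for missed points that lie in
    \<Sigma> and do not count towards \<open>?E\<close>.\<close>
  obtain F' where F': "F' \<in> M" "dom F' = X" "ran F' \<subseteq> ran F" "card ?D + card \<Sigma> \<le> card (X - ran F')"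
    using total_large_defect[OF F a fin] by blast
  let ?E = "X - \<Sigma> - ran F'"
  have finE: "finite ?E" using fin[OF F'(1,2)] by (rule finite_subset[rotated]) blast
  have "X - ran F' \<subseteq> ?E \<union> \<Sigma>" by blast
  then have "card (X - ran F') \<le> card ?E + card \<Sigma>"
    using card_mono[of "?E \<union> \<Sigma>"] card_Un_le[of ?E \<Sigma>] finE finite_\<Sigma> by (meson finite_UnI le_trans)
  with F'(4) have le: "card ?D \<le> card ?E" by linarith
  have "infinite (dom q)" using q(3) infinite_X by (metis finite_Diff2)
  then have infA: "infinite (avoiding q)" by (rule infinite_avoiding)
  obtain B where B: "finite B" "card B = card ?E - card ?D" "B \<subseteq> avoiding q"
    using infinite_arbitrarily_large[OF infA] by metis
  let ?C = "avoiding q - B"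
  have avX: "avoiding q \<subseteq> X - \<Sigma>" using avoiding_subset[of q] charts_dom_ran(1)[OF qc] by blast
  have D: "X - \<Sigma> - ?C = ?D \<union> B" using B(3) avX by blast
  have "card (?D \<union> B) = card ?D + card B" using finD B by (intro card_Un_disjoint) auto
  with B(2) le have "card ?E = card (X - \<Sigma> - ?C)" "finite ?E \<longleftrightarrow> finite (X - \<Sigma> - ?C)"
    using finD finE B(1) unfolding D by simp_all
  moreover have "?C \<subseteq> dom q - \<Sigma>" using avoiding_subset by blast
  moreover have "chart_image q ?C \<inter> \<Sigma> = {}" using chart_image_avoiding[OF qc, of ?C] by blast
  moreover have "infinite ?C" using infA B(1) by simp
  moreover have sub: "ran F' \<inter> \<Sigma> \<subseteq> ran F \<inter> \<Sigma>" using F'(3) by blast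
  moreover from sub q(2) have "ran F' \<inter> \<Sigma> \<subseteq> dom q" by blast
  ultimately obtain K where K: "K \<in> M" "dom K = X" "ran K \<subseteq> chart_image q ((ran F' \<inter> \<Sigma>) \<union> ?C)"
    "ran K \<inter> \<Sigma> \<subseteq> chart_image q (ran F' \<inter> \<Sigma>)"
    using push_total[OF F'(1,2) q(1), of ?C] by metis
  show ?thesis
  proof
    show "K \<in> M" "dom K = X" by fact+
    show "ran K \<subseteq> ran q" using K(3) by (auto simp: chart_image_def ran_def)
    show "ran K \<inter> \<Sigma> \<subseteq> chart_image q (ran F \<inter> \<Sigma>)"
      using K(4) chart_image_mono[OF sub] by blast
  qed
qed

text \<open>Otherwise \<open>ex_invariant_union\<close>, applied to the traces on \<Sigma> of ranges
  of total charts and to the \<open>q\<close> of finite collapse, yields a \<Gamma> with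
  \<open>M\<close> inside its \<open>Q\<close>. This \<Gamma> may be empty, so hypothesis
  \<open>Q\<close> has to cover the empty set as well.\<close>

lemma ex_total_infinite_defect:
  assumes a: "a \<in> M" "dom a = X" "ran a \<noteq> X"
    and Q: "\<And>\<Gamma>. \<Gamma> \<subseteq> \<Sigma> \<Longrightarrow> \<not> M \<subseteq> semigroup_Q X \<Gamma>"
  shows "\<exists>t\<in>M. dom t = X \<and> infinite (X - ran t)"
proof (rule ccontr)
  assume "\<not> ?thesis"
  then have fin: "\<And>f. f \<in> M \<Longrightarrow> dom f = X \<Longrightarrow> finite (X - ran f)" by blast
  let ?\<A> = "{ran f \<inter> \<Sigma> |f. f \<in> M \<and> dom f = X}"
  let ?Q = "{q \<in> M. finite (X - dom q)}"
  have step: "\<exists>B\<in>?\<A>. B \<subseteq> chart_image q A" if "A \<in> ?\<A>" "q \<in> ?Q" "A \<subseteq> dom q" for A q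
  proof -
    obtain F where F: "F \<in> M" "dom F = X" "A = ran F \<inter> \<Sigma>" using \<open>A \<in> ?\<A>\<close> by blast
    have q: "q \<in> M" "ran F \<inter> \<Sigma> \<subseteq> dom q" "finite (X - dom q)" using that F(3) by auto
    obtain K where "K \<in> M" "dom K = X" "ran K \<inter> \<Sigma> \<subseteq> chart_image q A"
      using push_finite_collapse[OF F(1,2) q a fin] F(3) by blast
    then show ?thesis by blast
  qed
  have fam: "?\<A> \<noteq> {}" "\<And>A. A \<in> ?\<A> \<Longrightarrow> A \<subseteq> \<Sigma>" "?Q \<subseteq> charts X"
    using a M_charts by blast+
  obtain \<Gamma> A where \<Gamma>: "\<Gamma> \<subseteq> \<Sigma>" "A \<in> ?\<A>" "A \<subseteq> \<Gamma>" "\<Gamma> = {} \<longrightarrow> A = {}"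
    and inv: "\<forall>q\<in>?Q. \<Gamma> \<subseteq> dom q \<longrightarrow> chart_image q \<Gamma> = \<Gamma>"
    by (rule ex_invariant_union[OF finite_\<Sigma> fam step]) blast+
  have "M \<subseteq> semigroup_Q X \<Gamma>"
  proof
    fix q assume q: "q \<in> M"
    have "chart_image q \<Gamma> = \<Gamma> \<and> finite (X - ran q)" if *: "\<Gamma> \<subseteq> dom q" "finite (X - dom q)"
    proof
      show "chart_image q \<Gamma> = \<Gamma>" using inv q * by blast
      \<comment> \<open>The trace \<open>A\<close> lies in \<Gamma>, so
        \<open>\<Gamma> \<subseteq> dom q\<close> allows \<open>F\<close> to be pushed through
        \<open>q\<close>. The resulting total \<open>K\<close> has finite defect and range inside
        \<open>ran q\<close>, which bounds the defect of \<open>q\<close>.\<close>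
      obtain F where F: "F \<in> M" "dom F = X" "ran F \<inter> \<Sigma> \<subseteq> dom q" using \<Gamma>(2,3) *(1) by blast
      obtain K where K: "K \<in> M" "dom K = X" "ran K \<subseteq> ran q"
        using push_finite_collapse[OF F(1,2) q F(3) *(2) a fin] by blast
      have "X - ran q \<subseteq> X - ran K" using K(3) by blast
      then show "finite (X - ran q)" using fin[OF K(1,2)] finite_subset by blast
    qed
    then show "q \<in> semigroup_Q X \<Gamma>" using q M_charts by (auto simp: semigroup_Q_eq)
  qed
  with Q[OF \<Gamma>(1)] show False by blast
qed

text \<open>The same minimality argument, now over total charts of infinite defect and against all
  \<open>q\<close> of infinite domain. The invariant \<Gamma> puts \<open>M\<close> inside its
  \<open>P\<close>, so \<Gamma> must be empty, and the range with trace \<open>A\<close> avoids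
  \<Sigma>.\<close>

lemma ex_total_avoiding:
  assumes a: "a \<in> M" "dom a = X" "ran a \<noteq> X"
    and Q: "\<And>\<Gamma>. \<Gamma> \<subseteq> \<Sigma> \<Longrightarrow> \<not> M \<subseteq> semigroup_Q X \<Gamma>"
    and P: "\<And>\<Gamma>. \<Gamma> \<subseteq> \<Sigma> \<Longrightarrow> \<Gamma> \<noteq> {} \<Longrightarrow> \<not> M \<subseteq> semigroup_P X \<Gamma>"
  obtains t where "t \<in> M" "dom t = X" "infinite (X - ran t)" "ran t \<inter> \<Sigma> = {}"
proof -
  let ?\<A> = "{ran f \<inter> \<Sigma> |f. f \<in> M \<and> dom f = X \<and> infinite (X - ran f)}"
  let ?Q = "{q \<in> M. infinite (dom q)}"
  have step: "\<exists>B\<in>?\<A>. B \<subseteq> chart_image q A" if "A \<in> ?\<A>" "q \<in> ?Q" "A \<subseteq> dom q" for A q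
  proof -
    obtain F where F: "F \<in> M" "dom F = X" "infinite (X - ran F)" "A = ran F \<inter> \<Sigma>"
      using \<open>A \<in> ?\<A>\<close> by blast
    have q: "q \<in> M" "ran F \<inter> \<Sigma> \<subseteq> dom q" "infinite (dom q)" using that F(4) by auto
    obtain K where "K \<in> M" "dom K = X" "infinite (X - ran K)" "ran K \<inter> \<Sigma> \<subseteq> chart_image q A"
      using push_infinite_defect[OF F(1-3) q] F(4) by metis
    then show ?thesis by blast
  qed
  have nonempty: "?\<A> \<noteq> {}" using ex_total_infinite_defect[OF a Q] by blast
  have fam: "\<And>A. A \<in> ?\<A> \<Longrightarrow> A \<subseteq> \<Sigma>" "?Q \<subseteq> charts X"
    using M_charts by blast+
  obtain \<Gamma> A where \<Gamma>: "\<Gamma> \<subseteq> \<Sigma>" "A \<in> ?\<A>" "A \<subseteq> \<Gamma>" "\<Gamma> = {} \<longrightarrow> A = {}"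
    and inv: "\<forall>q\<in>?Q. \<Gamma> \<subseteq> dom q \<longrightarrow> chart_image q \<Gamma> = \<Gamma>"
    by (rule ex_invariant_union[OF finite_\<Sigma> nonempty fam step]) blast+
  \<comment> \<open>Charts with finite domain, which \<open>inv\<close> does not reach, lie in
    \<open>P\<close> by definition.\<close>
  have "M \<subseteq> semigroup_P X \<Gamma>"
    using inv M_charts unfolding semigroup_P_eq by blast
  with P[OF \<Gamma>(1)] have "\<Gamma> = {}" by blast
  with \<Gamma> that show ?thesis by blast
qed

lemma Sym_subset:
  assumes t: "t \<in> M" "dom t = X" "infinite (X - ran t)" "ran t \<inter> \<Sigma> = {}"
    and s: "s \<in> charts X" "chart_inv s \<in> M" "dom s = X" "infinite (X - ran s)" "ran s \<inter> \<Sigma> = {}"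
  shows "Sym X \<subseteq> M"
proof
  fix p assume p: "p \<in> Sym X"
  then have pc: "p \<in> charts X" "dom p = X" "ran p = X" by (auto simp: Sym_def)
  have tc: "t \<in> charts X" using t M_charts by blast
  \<comment> \<open>Read left to right: the inverse of \<open>t\<close>, then \<open>p\<close>, then
    \<open>s\<close>. Its domain \<open>ran t\<close> and its range lie off \<Sigma> and leave
    infinitely many points of \<open>X - \<Sigma>\<close> uncovered, so it extends to some
    \<open>h\<close> in the stabiliser.\<close>
  define f where "f = s \<circ>\<^sub>m (p \<circ>\<^sub>m chart_inv t)"
  have f: "f \<in> charts X" unfolding f_def using s(1) pc(1) chart_inv_charts[OF tc] charts_comp by metis
  have dom: "dom f = ran t"
  proof
    show "dom f \<subseteq> ran t"
      unfolding f_def using dom_chart_inv[OF tc] dom_map_comp_subset[of s "p \<circ>\<^sub>m chart_inv t"]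
        dom_map_comp_subset[of p "chart_inv t"] by blast
    show "ran t \<subseteq> dom f"
    proof
      fix y assume "y \<in> ran t"
      then obtain x where x: "t x = Some y" by (auto simp: ran_def)
      then obtain z where z: "p x = Some z" using chartsD(1)[OF tc x] pc(2) by blast
      then obtain w where "s z = Some w" using chartsD(2)[OF pc(1) z] s(3) by blast
      with x z show "y \<in> dom f"
        by (auto simp: f_def map_comp_Some_iff chart_inv_eq_Some_iff[OF tc] dom_def)
    qed
  qed
  have "ran f \<subseteq> ran s" unfolding f_def by (rule ran_map_comp_subset)
  have sub: "ran t \<subseteq> X - \<Sigma>" "ran f \<subseteq> X - \<Sigma>"
    using charts_dom_ran(2)[OF tc] charts_dom_ran(2)[OF s(1)] \<open>ran f \<subseteq> ran s\<close> t(4) s(5) by blast+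
  have "(X - ran t) - \<Sigma> \<subseteq> X - \<Sigma> - ran t" "(X - ran s) - \<Sigma> \<subseteq> X - \<Sigma> - ran f"
    using \<open>ran f \<subseteq> ran s\<close> by blast+
  moreover have "infinite ((X - ran t) - \<Sigma>)" "infinite ((X - ran s) - \<Sigma>)"
    using t(3) s(4) finite_\<Sigma> by simp_all
  ultimately have "infinite (X - \<Sigma> - ran t)" "infinite (X - \<Sigma> - ran f)"
    using infinite_super by blast+
  moreover have "countable (X - \<Sigma> - ran t)" "countable (X - \<Sigma> - ran f)"
    by (rule countable_subset_X, blast)+
  ultimately obtain \<psi> where "bij_betw \<psi> (X - \<Sigma> - ran t) (X - \<Sigma> - ran f)"
    using countable_infinite_bij by metis
  then obtain h where h: "h \<in> pointwise_stabiliser X \<Sigma>" "\<And>y. y \<in> ran t \<Longrightarrow> h y = Some (the (f y))"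
    using stabiliser_extend[OF \<Sigma>_subset sub bij_betw_chart[OF f, unfolded dom]] by metis
  have hf: "h y = f y" if "y \<in> ran t" for y
  proof -
    have "y \<in> dom f" using that dom by blast
    then show ?thesis using h(2)[OF that] by (auto simp: dom_def)
  qed
  have "chart_inv s \<circ>\<^sub>m (h \<circ>\<^sub>m t) = p"
  proof
    fix x
    show "(chart_inv s \<circ>\<^sub>m (h \<circ>\<^sub>m t)) x = p x"
    proof (cases "x \<in> X")
      case True
      then obtain y where y: "t x = Some y" using t(2) by blast
      then obtain z where z: "p x = Some z" using True pc(2) by blast
      then obtain w where w: "s z = Some w" using chartsD(2)[OF pc(1) z] s(3) by blast
      have "f y = Some w" using y z w by (simp add: f_def map_comp_Some_iff chart_inv_eq_Some_iff[OF tc])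
      moreover have "y \<in> ran t" using y by (auto simp: ran_def)
      ultimately have "h y = Some w" using hf by simp
      moreover have "chart_inv s w = Some z" using w chart_inv_eq_Some_iff[OF s(1)] by simp
      ultimately show ?thesis using y z by (simp add: map_comp_def)
    next
      case False
      then have "t x = None" "p x = None" using t(2) pc(2) by auto
      then show ?thesis by (simp add: map_comp_def)
    qed
  qed
  moreover have "h \<in> M" using h(1) stabiliser_M by blast
  ultimately show "p \<in> M" using M_mult t(1) s(2) by metis
qed

end

section \<open>Classification of the maximal subsemigroups\<close>

context countable_charts
begin

text \<open>A proper subsemigroup containing \<open>M\<close> equals \<open>M\<close>, so the
  inequalities \<open>P\<close> and \<open>Q\<close> become the non-containments that
  \<open>ex_total_avoiding\<close> demands.\<close>

lemma maximal_total_avoiding: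
  assumes \<Sigma>: "\<Sigma> \<subseteq> X" "finite \<Sigma>"
    and M: "maximal_subsemigroup (sym_inv_monoid X) M" "pointwise_stabiliser X \<Sigma> \<subseteq> M" "\<not> Sym X \<subseteq> M"
    and P: "\<And>\<Gamma>. \<Gamma> \<subseteq> \<Sigma> \<Longrightarrow> \<Gamma> \<noteq> {} \<Longrightarrow> M \<noteq> semigroup_P X \<Gamma>"
    and Q: "\<And>\<Gamma>. \<Gamma> \<subseteq> \<Sigma> \<Longrightarrow> \<Gamma> \<noteq> {} \<Longrightarrow> M \<noteq> semigroup_Q X \<Gamma>"
  obtains t where "t \<in> M" "dom t = X" "infinite (X - ran t)" "ran t \<inter> \<Sigma> = {}"
proof -
  have sub: "subsemigroup (sym_inv_monoid X) M"
    and max: "\<And>S. subsemigroup (sym_inv_monoid X) S \<Longrightarrow> S \<noteq> charts X \<Longrightarrow> M \<subseteq> S \<Longrightarrow> S = M"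
    using M(1) unfolding maximal_subsemigroup_charts_iff by blast+
  interpret stabiliser_semigroup X \<Sigma> M
    using \<Sigma> M(2) sub by unfold_locales (auto simp: subsemigroup_charts_iff)
  obtain u where u: "u \<in> charts X" "dom u = X" "infinite (X - ran u)"
    using ex_total_chart_infinite_defect by blast
  \<comment> \<open>In \<open>?S\<close> every total chart is a permutation. It is a proper
    subsemigroup containing the symmetric group, so \<open>M\<close> escapes it through a total
    chart \<open>a\<close> that misses a point.\<close>
  let ?S = "{f \<in> charts X. dom f = X \<longrightarrow> ran f = X}"
  have "\<not> M \<subseteq> ?S"
  proof (rule maximal_not_subset[OF M(1,3)])
    show "subsemigroup (sym_inv_monoid X) ?S"
      unfolding subsemigroup_charts_iff
    proof (intro conjI ballI)
      show "?S \<noteq> {}" using idmap_stabiliser[OF \<Sigma>(1)] by (auto simp: pointwise_stabiliser_def Sym_def)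
      fix f g assume f: "f \<in> ?S" and g: "g \<in> ?S"
      have "ran (g \<circ>\<^sub>m f) = X" if dom: "dom (g \<circ>\<^sub>m f) = X"
      proof -
        \<comment> \<open>A total product makes \<open>f\<close> total, hence onto; this makes
          \<open>g\<close> total and thus onto in turn.\<close>
        have df: "dom f = X" using dom dom_map_comp_subset[of g f] f charts_dom_ran(1) by blast
        then have rf: "ran f = X" using f by blast
        have "ran f \<subseteq> dom g"
        proof
          fix y assume "y \<in> ran f"
          then obtain x where x: "f x = Some y" by (auto simp: ran_def)
          then have "x \<in> dom (g \<circ>\<^sub>m f)" using df dom by blast
          with x show "y \<in> dom g" by (auto simp: map_comp_Some_iff)
        qed
        then have "dom g = X" using rf g charts_dom_ran(1) by blast
        then have "ran g = X" using g by blast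
        show ?thesis
        proof
          show "ran (g \<circ>\<^sub>m f) \<subseteq> X" using ran_map_comp_subset[of g f] \<open>ran g = X\<close> by simp
          show "X \<subseteq> ran (g \<circ>\<^sub>m f)"
          proof
            fix z assume "z \<in> X"
            then obtain y where y: "g y = Some z" using \<open>ran g = X\<close> by (auto simp: ran_def)
            then have "y \<in> ran f" using rf chartsD(1)[of g X] g by blast
            then obtain x where "f x = Some y" by (auto simp: ran_def)
            with y show "z \<in> ran (g \<circ>\<^sub>m f)" by (auto simp: ran_def map_comp_Some_iff)
          qed
        qed
      qed
      then show "g \<circ>\<^sub>m f \<in> ?S" using f g charts_comp by blast
    qed blast
    have "u \<notin> ?S" using u by auto
    then show "?S \<noteq> charts X" using u(1) by blast
    show "Sym X \<subseteq> ?S" by (auto simp: Sym_def)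
  qed
  then obtain a where a: "a \<in> M" "dom a = X" "ran a \<noteq> X" using M_charts by blast
  have notQ: "\<not> M \<subseteq> semigroup_Q X \<Gamma>" if \<Gamma>: "\<Gamma> \<subseteq> \<Sigma>" for \<Gamma>
  proof -
    have S: "subsemigroup (sym_inv_monoid X) (semigroup_Q X \<Gamma>)"
      using subsemigroup_Q \<Gamma> \<Sigma>(1) by blast
    have proper: "semigroup_Q X \<Gamma> \<noteq> charts X" if "\<Gamma> = {}"
    proof -
      have "u \<notin> semigroup_Q X \<Gamma>" using u that by (simp add: semigroup_Q_eq)
      then show ?thesis using u(1) by blast
    qed
    show ?thesis
    proof (cases "\<Gamma> = {}")
      \<comment> \<open>For empty \<Gamma>, \<open>Q\<close> contains the symmetric group and is not
        one of the listed semigroups; it is excluded through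
        \<open>\<not> Sym X \<subseteq> M\<close>.\<close>
      case True
      have "Sym X \<subseteq> semigroup_Q X \<Gamma>"
        using True by (auto simp: Sym_def semigroup_Q_eq chart_image_def)
      then show ?thesis using maximal_not_subset[OF M(1,3) S proper[OF True]] by blast
    next
      case False
      have "semigroup_Q X \<Gamma> \<noteq> charts X"
        using not_Sym_subset(2)[of \<Gamma>] False \<Gamma> \<Sigma> finite_subset Sym_subset_charts by blast
      then show ?thesis using max[OF S] Q[OF \<Gamma> False] by blast
    qed
  qed
  have notP: "\<not> M \<subseteq> semigroup_P X \<Gamma>" if \<Gamma>: "\<Gamma> \<subseteq> \<Sigma>" "\<Gamma> \<noteq> {}" for \<Gamma>
  proof -
    have "semigroup_P X \<Gamma> \<noteq> charts X"
      using not_Sym_subset(1)[of \<Gamma>] \<Gamma> \<Sigma> finite_subset Sym_subset_charts by blast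
    moreover have "subsemigroup (sym_inv_monoid X) (semigroup_P X \<Gamma>)"
      using subsemigroup_P \<Gamma> \<Sigma>(1) by blast
    ultimately show ?thesis using max P[OF \<Gamma>] by blast
  qed
  show ?thesis using ex_total_avoiding[OF a notQ notP] that by blast
qed

lemma chart_inv_image_maximal_conditions:
  assumes "maximal_subsemigroup (sym_inv_monoid X) M" "pointwise_stabiliser X \<Sigma> \<subseteq> M" "\<not> Sym X \<subseteq> M"
  shows "maximal_subsemigroup (sym_inv_monoid X) (chart_inv ` M)"
    "pointwise_stabiliser X \<Sigma> \<subseteq> chart_inv ` M" "\<not> Sym X \<subseteq> chart_inv ` M"
proof -
  have MX: "M \<subseteq> charts X"
    using assms(1) by (simp add: maximal_subsemigroup_charts_iff subsemigroup_charts_iff)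
  show "maximal_subsemigroup (sym_inv_monoid X) (chart_inv ` M)"
    using assms(1) by (rule maximal_subsemigroup_chart_inv)
  show "pointwise_stabiliser X \<Sigma> \<subseteq> chart_inv ` M"
    using assms(2) MX chart_inv_stabiliser by (intro subset_chart_inv_image[of _ _ X]) auto
  show "\<not> Sym X \<subseteq> chart_inv ` M"
  proof
    assume "Sym X \<subseteq> chart_inv ` M"
    then have "Sym X \<subseteq> chart_inv ` chart_inv ` M"
      using Sym_subset_charts chart_inv_Sym by (rule subset_chart_inv_image)
    with image_chart_inv_image[OF MX] assms(3) show False by simp
  qed
qed

text \<open>Were \<open>M\<close> none of the listed semigroups,
  \<open>maximal_total_avoiding\<close> would apply both to \<open>M\<close> and to the set of its
  inverses, giving the two charts from which \<open>Sym_subset\<close> builds every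
  permutation.\<close>

lemma maximal_characterisation:
  assumes \<Sigma>: "\<Sigma> \<subseteq> X" "finite \<Sigma>"
    and M: "maximal_subsemigroup (sym_inv_monoid X) M" "pointwise_stabiliser X \<Sigma> \<subseteq> M" "\<not> Sym X \<subseteq> M"
  shows "\<exists>\<Gamma>\<subseteq>\<Sigma>. \<Gamma> \<noteq> {} \<and> M \<in> {semigroup_P X \<Gamma>, semigroup_P_inv X \<Gamma>, semigroup_Q X \<Gamma>, semigroup_Q_inv X \<Gamma>}"
proof (rule ccontr)
  assume contra: "\<not> ?thesis"
  have MX: "M \<subseteq> charts X" and sub: "subsemigroup (sym_inv_monoid X) M"
    using M(1) by (simp_all add: maximal_subsemigroup_charts_iff subsemigroup_charts_iff)
  interpret stabiliser_semigroup X \<Sigma> M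
    using \<Sigma> M(2) sub by unfold_locales (auto simp: subsemigroup_charts_iff)
  obtain t where t: "t \<in> M" "dom t = X" "infinite (X - ran t)" "ran t \<inter> \<Sigma> = {}"
    using maximal_total_avoiding[OF \<Sigma> M] contra by blast
  \<comment> \<open>Inverting once more would turn such an equality into one of \<open>M\<close>
    with a dual semigroup, which \<open>contra\<close> forbids.\<close>
  have "chart_inv ` M \<noteq> semigroup_P X \<Gamma>" "chart_inv ` M \<noteq> semigroup_Q X \<Gamma>"
    if \<Gamma>: "\<Gamma> \<subseteq> \<Sigma>" "\<Gamma> \<noteq> {}" for \<Gamma>
  proof -
    have "finite \<Gamma>" using \<Gamma>(1) \<Sigma>(2) finite_subset by blast
    moreover have "M \<noteq> semigroup_P_inv X \<Gamma>" "M \<noteq> semigroup_Q_inv X \<Gamma>" using contra \<Gamma> by blast+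
    ultimately show "chart_inv ` M \<noteq> semigroup_P X \<Gamma>" "chart_inv ` M \<noteq> semigroup_Q X \<Gamma>"
      using image_chart_inv_image[OF MX] chart_inv_semigroup_P chart_inv_semigroup_Q by metis+
  qed
  then obtain s where s: "s \<in> chart_inv ` M" "dom s = X" "infinite (X - ran s)" "ran s \<inter> \<Sigma> = {}"
    using maximal_total_avoiding[OF \<Sigma> chart_inv_image_maximal_conditions[OF M]] by blast
  have "s \<in> charts X" "chart_inv s \<in> M"
    using s(1) MX chart_inv_charts[of _ X] chart_inv_chart_inv[of _ X] by auto
  then have "Sym X \<subseteq> M" using Sym_subset[OF t _ _ s(2-4)] by blast
  with M(3) show False by blast
qed

end

theorem theorem3p24:
  fixes X \<Sigma> :: "'a set"
  assumes "countable X" and "infinite X"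
    and "\<Sigma> \<subseteq> X" and "finite \<Sigma>" and "\<Sigma> \<noteq> {}"
  shows "{M. maximal_subsemigroup (sym_inv_monoid X) M \<and>
             pointwise_stabiliser X \<Sigma> \<subseteq> M \<and> \<not> Sym X \<subseteq> M} =
         (\<Union>\<Gamma>\<in>{\<Gamma>. \<Gamma> \<subseteq> \<Sigma> \<and> \<Gamma> \<noteq> {}}. {semigroup_P X \<Gamma>, semigroup_P_inv X \<Gamma>,
            semigroup_Q X \<Gamma>, semigroup_Q_inv X \<Gamma>})"
    (is "?L = ?R")
proof -
  interpret countable_charts X using assms by unfold_locales
  show ?thesis
  proof
    show "?L \<subseteq> ?R" using maximal_characterisation[OF assms(3,4)] by blast
    show "?R \<subseteq> ?L"
    proof
      fix M assume "M \<in> ?R"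
      then obtain \<Gamma> where \<Gamma>: "\<Gamma> \<subseteq> \<Sigma>" "\<Gamma> \<noteq> {}" and
        M: "M \<in> {semigroup_P X \<Gamma>, semigroup_P_inv X \<Gamma>, semigroup_Q X \<Gamma>, semigroup_Q_inv X \<Gamma>}"
        by blast
      then have fin: "finite \<Gamma>" and \<Gamma>X: "\<Gamma> \<subseteq> X" using assms(3,4) finite_subset by blast+
      note P = maximal_P[OF fin \<Gamma>X \<Gamma>(2)] stabiliser_subset_P[OF \<Gamma>(1)] not_Sym_subset(1)[OF fin \<Gamma>X \<Gamma>(2)]
      note Q = maximal_Q[OF fin \<Gamma>X \<Gamma>(2)] stabiliser_subset_Q[OF \<Gamma>(1)] not_Sym_subset(2)[OF fin \<Gamma>X \<Gamma>(2)]
      note P' = chart_inv_image_maximal_conditions[OF P, unfolded chart_inv_semigroup_P[OF fin]]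
      note Q' = chart_inv_image_maximal_conditions[OF Q, unfolded chart_inv_semigroup_Q[OF fin]]
      show "M \<in> ?L" using M P Q P' Q' by blast
    qed
  qed
qed

end
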